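(* Let $(\mathfrak h,[\cdot,\cdots,\cdot]_{\mathfrak h})$ be an $n$-Lie algebra. Then $(\mathfrak h,[\cdot,\cdots,\cdot]_{\mathfrak h})$ has a phase space if and only if it is sub-adjacent to an $n$-pre-Lie algebra, i.e. there is an $n$-pre-Lie algebra structure $\{\cdot,\cdots,\cdot\}$ on the vector space $\mathfrak h$ whose sub-adjacent $n$-Lie algebra is $(\mathfrak h,[\cdot,\cdots,\cdot]_{\mathfrak h})$.
   Context: $\mathbb K$ is a field of characteristic $0$; all vector spaces are finite dimensional over $\mathbb K$; $n\ge 2$ is an integer; a hat means omission. An $n$-Lie algebra is a vector space $A$ with a skew-symmetric $n$-linear map $[\cdot,\cdots,\cdot]:A^n\to A$ such that $[x_1,\dots,x_{n-1},[y_1,\dots,y_n]]=\sum_{i=1}^n[y_1,\dots,y_{i-1},[x_1,\dots,x_{n-1},y_i],y_{i+1},\dots,y_n]$ for all $x_i,y_i\in A$. An $n$-pre-Lie algebra is a vector space $A$ with an $n$-linear map $\{\cdot,\cdots,\cdot\}:(\wedge^{n-1}A)\otimes A\to A$ (so skew-symmetric in the first $n-1$ arguments) such that for all $x_i,y_i\in A$: $$\{x_1,\dots,x_{n-1},\{y_1,\dots,y_n\}\}=\sum_{i=1}^{n-1}\{y_1,\dots,y_{i-1},[x_1,\dots,x_{n-1},y_i]^C,y_{i+1},\dots,y_n\}+\{y_1,\dots,y_{n-1},\{x_1,\dots,x_{n-1},y_n\}\},$$ $$\{[x_1,\dots,x_n]^C,y_1,\dots,y_{n-1}\}=\sum_{i=1}^n(-1)^{n-i}\{x_1,\dots,\widehat{x_i},\dots,x_n,\{x_i,y_1,\dots,y_{n-1}\}\},$$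 where $[x_1,\dots,x_n]^C=\sum_{i=1}^n(-1)^{n-i}\{x_1,\dots,\widehat{x_i},\dots,x_n,x_i\}$. Then $(A,[\cdot,\cdots,\cdot]^C)$ is an $n$-Lie algebra, called the sub-adjacent $n$-Lie algebra. A symplectic structure on an $n$-Lie algebra $(A,[\cdot,\cdots,\cdot])$ is a nondegenerate skew-symmetric bilinear form $B$ on $A$ with $B([x_1,\dots,x_n],y)=-\sum_{i=1}^n(-1)^{n-i}B(x_i,[x_1,\dots,\widehat{x_i},\dots,x_n,y])$ for all $x_i,y\in A$; then $(A,[\cdot,\cdots,\cdot],B)$ is a symplectic $n$-Lie algebra. A phase space of an $n$-Lie algebra $(\mathfrak h,[\cdot,\cdots,\cdot]_{\mathfrak h})$ is a symplectic $n$-Lie algebra $(\mathfrak h\oplus\mathfrak h^*,[\cdot,\cdots,\cdot],B)$, where $B(x+f,y+g)=\langle f,y\rangle-\langle g,x\rangle$ for $x,y\in\mathfrak h$, $f,g\in\mathfrak h^*$, such that $(\mathfrak h,[\cdot,\cdots,\cdot]_{\mathfrak h})$ (with its given bracket) and $\mathfrak h^*$ are $n$-Lie subalgebras of $\mathfrak h\oplus\mathfrak h^*$. *)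

theory Defs
  imports
    Complex_Main
    "HOL-Library.NList"
    "HOL-Library.Product_Plus"
    "HOL-Library.Function_Algebras"
begin

text \<open>
  An \<open>n\<close>-ary operation on a space \<open>V\<close> is a function \<open>br :: 'a list \<Rightarrow> 'a\<close>, only considered on
  \<open>nlists n V\<close>, the lists of length \<open>n\<close> with entries in \<open>V\<close>. Positions are counted from \<open>0\<close>, so the
  sign \<open>(-1)^(n-i)\<close> attached to the \<open>i\<close>-th argument (\<open>1 \<le> i \<le> n\<close>) becomes
  \<open>(-1)^(n - Suc i)\<close> with \<open>i < n\<close>.
\<close>

definition omit_nth :: "nat \<Rightarrow> 'a list \<Rightarrow> 'a list" where
  "omit_nth i xs = take i xs @ drop (Suc i) xs"

text \<open>A finite-dimensional space is a finitely spanned subspace \<open>V\<close> of an ambient vector space,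
  which itself may have infinite dimension.\<close>

locale fin_dim_space = vector_space scale
  for scale :: "'k::field_char_0 \<Rightarrow> 'a::ab_group_add \<Rightarrow> 'a" +
  fixes V :: "'a set"
  assumes subspace_carrier: "subspace V"
    and finitely_spanned: "\<exists>S. finite S \<and> S \<subseteq> V \<and> V \<subseteq> span S"

locale multilinear_operation = fin_dim_space scale V
  for n :: nat and scale :: "'k::field_char_0 \<Rightarrow> 'a::ab_group_add \<Rightarrow> 'a" and V :: "'a set" +
  fixes br :: "'a list \<Rightarrow> 'a"
  assumes closed: "xs \<in> nlists n V \<Longrightarrow> br xs \<in> V"
    and additive: "\<lbrakk>xs \<in> nlists n V; i < n; u \<in> V; v \<in> V\<rbrakk>
      \<Longrightarrow> br (xs[i := u + v]) = br (xs[i := u]) + br (xs[i := v])"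
    and homogeneous: "\<lbrakk>xs \<in> nlists n V; i < n; u \<in> V\<rbrakk>
      \<Longrightarrow> br (xs[i := scale c u]) = scale c (br (xs[i := u]))"

locale n_Lie_algebra = multilinear_operation n scale V br
  for n :: nat and scale :: "'k::field_char_0 \<Rightarrow> 'a::ab_group_add \<Rightarrow> 'a" and V :: "'a set"
    and br :: "'a list \<Rightarrow> 'a" +
  assumes skew: "\<lbrakk>xs \<in> nlists n V; i < n; j < n; i \<noteq> j\<rbrakk>
      \<Longrightarrow> br (xs[i := xs ! j, j := xs ! i]) = - br xs"
    and fundamental_identity: "\<lbrakk>xs \<in> nlists (n - 1) V; ys \<in> nlists n V\<rbrakk>
      \<Longrightarrow> br (xs @ [br ys]) = (\<Sum>i<n. br (ys[i := br (xs @ [ys ! i])]))"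

definition commutator ::
  "nat \<Rightarrow> ('k::field_char_0 \<Rightarrow> 'a::ab_group_add \<Rightarrow> 'a) \<Rightarrow> ('a list \<Rightarrow> 'a) \<Rightarrow> 'a list \<Rightarrow> 'a" where
  "commutator n scale pr xs =
    (\<Sum>i<n. scale ((-1) ^ (n - Suc i)) (pr (omit_nth i xs @ [xs ! i])))"

locale n_pre_Lie_algebra = multilinear_operation n scale V pr
  for n :: nat and scale :: "'k::field_char_0 \<Rightarrow> 'a::ab_group_add \<Rightarrow> 'a" and V :: "'a set"
    and pr :: "'a list \<Rightarrow> 'a" +
  assumes skew: "\<lbrakk>xs \<in> nlists n V; i < n - 1; j < n - 1; i \<noteq> j\<rbrakk>
      \<Longrightarrow> pr (xs[i := xs ! j, j := xs ! i]) = - pr xs"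
    and derivation_identity: "\<lbrakk>xs \<in> nlists (n - 1) V; ys \<in> nlists n V\<rbrakk>
      \<Longrightarrow> pr (xs @ [pr ys]) =
          (\<Sum>i<n - 1. pr (ys[i := commutator n scale pr (xs @ [ys ! i])]))
          + pr (ys[n - 1 := pr (xs @ [ys ! (n - 1)])])"
    and commutator_identity: "\<lbrakk>xs \<in> nlists n V; ys \<in> nlists (n - 1) V\<rbrakk>
      \<Longrightarrow> pr (commutator n scale pr xs # ys) =
          (\<Sum>i<n. scale ((-1) ^ (n - Suc i)) (pr (omit_nth i xs @ [pr (xs ! i # ys)])))"

text \<open>The \<open>n\<close>-Lie algebra \<open>(V, br)\<close> is the sub-adjacent \<open>n\<close>-Lie algebra of \<open>(V, pr)\<close>.\<close>

definition sub_adjacent ::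
  "nat \<Rightarrow> ('k::field_char_0 \<Rightarrow> 'a::ab_group_add \<Rightarrow> 'a) \<Rightarrow> 'a set \<Rightarrow>
   ('a list \<Rightarrow> 'a) \<Rightarrow> ('a list \<Rightarrow> 'a) \<Rightarrow> bool" where
  "sub_adjacent n scale V pr br \<longleftrightarrow>
    n_pre_Lie_algebra n scale V pr \<and> (\<forall>xs\<in>nlists n V. commutator n scale pr xs = br xs)"

locale symplectic_n_Lie_algebra = n_Lie_algebra n scale V br
  for n :: nat and scale :: "'k::field_char_0 \<Rightarrow> 'a::ab_group_add \<Rightarrow> 'a" and V :: "'a set"
    and br :: "'a list \<Rightarrow> 'a" +
  fixes B :: "'a \<Rightarrow> 'a \<Rightarrow> 'k"
  assumes form_add_left: "\<lbrakk>x \<in> V; y \<in> V; z \<in> V\<rbrakk> \<Longrightarrow> B (x + y) z = B x z + B y z"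
    and form_scale_left: "\<lbrakk>x \<in> V; y \<in> V\<rbrakk> \<Longrightarrow> B (scale c x) y = c * B x y"
    and form_add_right: "\<lbrakk>x \<in> V; y \<in> V; z \<in> V\<rbrakk> \<Longrightarrow> B x (y + z) = B x y + B x z"
    and form_scale_right: "\<lbrakk>x \<in> V; y \<in> V\<rbrakk> \<Longrightarrow> B x (scale c y) = c * B x y"
    and form_skew: "\<lbrakk>x \<in> V; y \<in> V\<rbrakk> \<Longrightarrow> B x y = - B y x"
    and form_nondegenerate: "\<lbrakk>x \<in> V; \<And>y. y \<in> V \<Longrightarrow> B x y = 0\<rbrakk> \<Longrightarrow> x = 0"
    and form_bracket: "\<lbrakk>xs \<in> nlists n V; y \<in> V\<rbrakk>
      \<Longrightarrow> B (br xs) y =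
          - (\<Sum>i<n. (-1) ^ (n - Suc i) * B (xs ! i) (br (omit_nth i xs @ [y])))"

definition n_Lie_subalgebra ::
  "nat \<Rightarrow> ('k::field_char_0 \<Rightarrow> 'a::ab_group_add \<Rightarrow> 'a) \<Rightarrow> 'a set \<Rightarrow> ('a list \<Rightarrow> 'a) \<Rightarrow> 'a set \<Rightarrow> bool"
  where
  "n_Lie_subalgebra n scale V br W \<longleftrightarrow>
    module.subspace scale W \<and> W \<subseteq> V \<and> (\<forall>xs\<in>nlists n W. br xs \<in> W)"

text \<open>
  The space \<open>\<hh>\<close> is the whole type \<open>'a\<close>, and \<open>\<hh> \<oplus> \<hh>\<^sup>*\<close> is the subspace \<open>double_carrier\<close> of
  \<open>'a \<times> ('a \<Rightarrow> 'k)\<close>, where all functions \<open>'a \<Rightarrow> 'k\<close> carry the pointwise structure.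
\<close>

definition dual_carrier :: "('k::field_char_0 \<Rightarrow> 'a::ab_group_add \<Rightarrow> 'a) \<Rightarrow> ('a \<Rightarrow> 'k) set" where
  "dual_carrier scale = {f. Vector_Spaces.linear scale (*) f}"

definition double_carrier ::
  "('k::field_char_0 \<Rightarrow> 'a::ab_group_add \<Rightarrow> 'a) \<Rightarrow> ('a \<times> ('a \<Rightarrow> 'k)) set" where
  "double_carrier scale = UNIV \<times> dual_carrier scale"

definition double_scale ::
  "('k::field_char_0 \<Rightarrow> 'a::ab_group_add \<Rightarrow> 'a) \<Rightarrow> 'k \<Rightarrow> 'a \<times> ('a \<Rightarrow> 'k) \<Rightarrow> 'a \<times> ('a \<Rightarrow> 'k)" where
  "double_scale scale c = (\<lambda>(x, f). (scale c x, \<lambda>y. c * f y))"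

definition double_form :: "'a \<times> ('a \<Rightarrow> 'k) \<Rightarrow> 'a \<times> ('a \<Rightarrow> 'k) \<Rightarrow> 'k::field_char_0" where
  "double_form = (\<lambda>(x, f) (y, g). f y - g x)"

text \<open>\<open>(\<hh> \<oplus> \<hh>\<^sup>*, br')\<close> with the canonical form is a phase space of \<open>(\<hh>, br)\<close>.\<close>

definition phase_space ::
  "nat \<Rightarrow> ('k::field_char_0 \<Rightarrow> 'a::ab_group_add \<Rightarrow> 'a) \<Rightarrow> ('a list \<Rightarrow> 'a) \<Rightarrow>
   (('a \<times> ('a \<Rightarrow> 'k)) list \<Rightarrow> 'a \<times> ('a \<Rightarrow> 'k)) \<Rightarrow> bool" where
  "phase_space n scale br br' \<longleftrightarrow>
    symplectic_n_Lie_algebra n (double_scale scale) (double_carrier scale) br' double_form \<and>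
    n_Lie_subalgebra n (double_scale scale) (double_carrier scale) br' (UNIV \<times> {0}) \<and>
    (\<forall>xs\<in>nlists n UNIV. br' (map (\<lambda>x. (x, 0)) xs) = (br xs, 0)) \<and>
    n_Lie_subalgebra n (double_scale scale) (double_carrier scale) br' ({0} \<times> dual_carrier scale)"

end

(*
  From a phase space, the product on h is read off the form: {x_1, ..., x_n} is the vector with
  B({x_1, ..., x_n}, u) = - B(x_n, [x_1, ..., x_{n-1}, u]) for all u.  Conversely, an n-pre-Lie
  product gives the semidirect product of h with the dual L^* of its left multiplication.  Both
  directions rest on the fact that the dual of a representation rho is again a representation,
  more precisely on the identity

    rho([x_1, ..., x_n], ys) = - sum_i (-1)^(n-i) rho(x_i, ys) rho(x_1, ..., omit x_i, ..., x_n).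

  To prove it, regard the 2(n-1) vectors x_i, y_j as indexed by a set Z, and let P(S) be the suitably
  signed composite rho(S) rho(Z - S) for S of size n-1.  The two axioms of a representation become
  sign-free relations between P and D(X) = rho([Z - X], X), for X of size n-2.  They imply that the
  defect U(X) of the identity satisfies sum_{x in S} U(S - x) = 0 for all S of size n-1, and in
  characteristic 0 this forces U = 0.
*)

theory Submission
  imports Defs
begin

text \<open>Transposition reverses the order of composites. \<open>action_commutator\<close>
  survives this after rearranging and changing signs, but \<open>action_bracket\<close> becomes an
  expansion in which the factor containing \<open>x_i\<close> acts last instead of first. For n = 2
  both expansions are the usual commutator relation; for larger n they differ, and this is the
  obstacle. The sign of a composite, -1 to the power of the sum of S, is up to a factor depending
  only on the size of S the sign of the shuffle that lists S before its complement. With m = n - 2,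
  the vanishing of U is the injectivity of the inclusion map from functions on m-subsets to
  functions on (m+1)-subsets of a set with 2m + 2 elements. It needs 2m < 2m + 2 and cancellation of
  positive integers. From a phase space, the dual identity of the adjoint action of the double
  yields \<open>commutator_identity\<close>. In the converse, the dual identity of left
  multiplication yields those terms of the fundamental identity whose functional comes from one of
  the n - 1 acting arguments.\<close>

declare nlistsE_length [simp del] nlistsE_set [simp del]

text \<open>Characteristic 0 lets positive integers be cancelled. Through the sublocale below, the
  lemmas proved here apply both to the algebra and to its double.\<close>

locale vector_space_char_0 = vector_space scale
  for scale :: "'k::field_char_0 \<Rightarrow> 'a::ab_group_add \<Rightarrow> 'a"

sublocale fin_dim_space \<subseteq> vector_space_char_0 ..

section \<open>Sums over subsets\<close>

context vector_space_char_0
begin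

text \<open>Double counting: a set X of size m arises as S - {x} once for each x outside X. Summing
  the hypothesis over all S thus gives card Z - m times the sum in question.\<close>

lemma sum_subsets_avoiding:
  fixes U :: "nat set \<Rightarrow> 'a"
  assumes "finite Z"
    and sums: "\<And>S. S \<subseteq> Z \<Longrightarrow> card S = Suc m \<Longrightarrow> (\<Sum>x\<in>S. U (S - {x})) = 0"
    and card: "card Z \<noteq> m"
  shows "(\<Sum>X | X \<subseteq> Z \<and> card X = m. U X) = 0"
proof -
  have fin: "finite X" if "X \<subseteq> Z" for X
    using that assms(1) by (rule finite_subset)
  have fS: "finite {S. S \<subseteq> Z \<and> P S}" for P
    using assms(1) by auto
  have "0 = (\<Sum>S | S \<subseteq> Z \<and> card S = Suc m. \<Sum>x\<in>S. U (S - {x}))"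
    using sums by simp
  also have "\<dots> = (\<Sum>(S, x)\<in>(SIGMA S:{S. S \<subseteq> Z \<and> card S = Suc m}. S). U (S - {x}))"
    using fS fin by (subst sum.Sigma) auto
  also have "\<dots> = (\<Sum>(X, x)\<in>(SIGMA X:{X. X \<subseteq> Z \<and> card X = m}. Z - X). U X)"
    by (rule sum.reindex_bij_witness[where i = "\<lambda>(X, x). (insert x X, x)"
          and j = "\<lambda>(S, x). (S - {x}, x)"])
      (auto simp: fin insert_absorb)
  also have "\<dots> = (\<Sum>X | X \<subseteq> Z \<and> card X = m. \<Sum>x\<in>Z - X. U X)"
    using fS assms(1) by (subst sum.Sigma) auto
  also have "\<dots> = (\<Sum>X | X \<subseteq> Z \<and> card X = m. scale (of_nat (card Z - m)) (U X))"
    by (rule sum.cong) (auto simp: sum_constant_scale card_Diff_subset fin)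
  also have "\<dots> = scale (of_nat (card Z - m)) (\<Sum>X | X \<subseteq> Z \<and> card X = m. U X)"
    by (simp add: scale_sum_right)
  finally have *: "scale (of_nat (card Z - m)) (\<Sum>X | X \<subseteq> Z \<and> card X = m. U X) = 0"
    by simp
  show ?thesis
  \<comment> \<open>For card Z < m the truncated difference is 0 and cannot be cancelled, but then
    the sum is empty.\<close>
  proof (cases "card Z < m")
    case True
    then have "{X. X \<subseteq> Z \<and> card X = m} = {}"
      using card_mono[OF assms(1)] leD by blast
    then show ?thesis by (simp only: sum.empty)
  next
    case False
    then show ?thesis using * card by simp
  qed
qed

text \<open>Induction on A: the sets containing A either contain a or avoid it. The sums over all of
  them and over those avoiding a vanish by induction, so the sum over those containing a does too.
  The element a passes from A to W, which preserves the cardinality bound.\<close>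

lemma sum_subsets_between:
  fixes U :: "nat set \<Rightarrow> 'a"
  assumes "finite Z" and "finite A"
    and sums: "\<And>S. S \<subseteq> Z \<Longrightarrow> card S = Suc m \<Longrightarrow> (\<Sum>x\<in>S. U (S - {x})) = 0"
    and "A \<subseteq> Z" "W \<subseteq> Z" "A \<inter> W = {}" "card A + card W + m < card Z"
  shows "(\<Sum>X | A \<subseteq> X \<and> X \<subseteq> Z - W \<and> card X = m. U X) = 0"
  using assms(2,4-)
proof (induction A arbitrary: W)
  case empty
  have "finite W" using assms(1) empty finite_subset by blast
  then have "card (Z - W) = card Z - card W"
    using empty by (simp add: card_Diff_subset)
  then have "(\<Sum>X | X \<subseteq> Z - W \<and> card X = m. U X) = 0"
    using empty assms(1) by (intro sum_subsets_avoiding) (auto intro: sums)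
  then show ?case by simp
next
  case (insert a A)
  have fin: "finite {X. A \<subseteq> X \<and> X \<subseteq> Z - W \<and> card X = m}"
    using assms(1) by (rule_tac finite_subset[of _ "Pow Z"]) auto
  have W: "finite W" using insert.prems(2) assms(1) finite_subset by blast
  have a: "a \<in> Z" "a \<notin> W" using insert.prems by auto
  have split: "{X. A \<subseteq> X \<and> X \<subseteq> Z - W \<and> card X = m} =
      {X. insert a A \<subseteq> X \<and> X \<subseteq> Z - W \<and> card X = m} \<union>
      {X. A \<subseteq> X \<and> X \<subseteq> Z - insert a W \<and> card X = m}"
    by blast
  have "(\<Sum>X | A \<subseteq> X \<and> X \<subseteq> Z - W \<and> card X = m. U X) = 0"
    using insert.prems insert.hyps by (intro insert.IH) auto
  moreover have "(\<Sum>X | A \<subseteq> X \<and> X \<subseteq> Z - insert a W \<and> card X = m. U X) = 0"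
    using insert.prems insert.hyps W a by (intro insert.IH) auto
  moreover have "(\<Sum>X | A \<subseteq> X \<and> X \<subseteq> Z - W \<and> card X = m. U X) =
      (\<Sum>X | insert a A \<subseteq> X \<and> X \<subseteq> Z - W \<and> card X = m. U X) +
      (\<Sum>X | A \<subseteq> X \<and> X \<subseteq> Z - insert a W \<and> card X = m. U X)"
    unfolding split using fin[unfolded split] by (intro sum.union_disjoint) auto
  ultimately show ?case by simp
qed

text \<open>Take A = X and W empty in \<open>sum_subsets_between\<close>: the only set of size m
  containing X is X itself. This is the full column rank of the inclusion matrix between m-subsets
  and (m+1)-subsets.\<close>

lemma inclusion_sums_injective:
  fixes U :: "nat set \<Rightarrow> 'a"
  assumes "finite Z"
    and "\<And>S. S \<subseteq> Z \<Longrightarrow> card S = Suc m \<Longrightarrow> (\<Sum>x\<in>S. U (S - {x})) = 0"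
    and "X \<subseteq> Z" "card X = m" "2 * m < card Z"
  shows "U X = 0"
proof -
  have "finite X" using assms(1,3) by (rule_tac finite_subset)
  have "{Y. X \<subseteq> Y \<and> Y \<subseteq> Z - {} \<and> card Y = m} = {X}"
  proof (intro equalityI subsetI)
    fix Y assume Y: "Y \<in> {Y. X \<subseteq> Y \<and> Y \<subseteq> Z - {} \<and> card Y = m}"
    then have "finite Y" using assms(1) by (auto intro: finite_subset)
    then have "X = Y" using Y assms(4) by (intro card_subset_eq) auto
    then show "Y \<in> {X}" by simp
  qed (use assms in auto)
  moreover have "(\<Sum>Y | X \<subseteq> Y \<and> Y \<subseteq> Z - {} \<and> card Y = m. U Y) = 0"
    using assms \<open>finite X\<close> by (intro sum_subsets_between) auto
  ultimately show ?thesis by simp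
qed

text \<open>The difference of the two sides, as a function of \<open>X\<close>, satisfies the hypothesis of
  \<open>inclusion_sums_injective\<close>.\<close>

lemma complementary_identity:
  fixes P D :: "nat set \<Rightarrow> 'a"
  assumes Z: "finite Z" "card Z = 2 * Suc m" and c: "c * c = 1"
    and R2: "\<And>X. X \<subseteq> Z \<Longrightarrow> card X = m \<Longrightarrow> D X = (\<Sum>s\<in>Z - X. P (Z - X - {s}))"
    and R1: "\<And>S. S \<subseteq> Z \<Longrightarrow> card S = Suc m \<Longrightarrow>
      P S - scale c (P (Z - S)) = (\<Sum>t\<in>Z - S. D (Z - S - {t}))"
    and X: "X \<subseteq> Z" "card X = m"
  shows "D X = - scale c (\<Sum>s\<in>Z - X. P (insert s X))"
proof -
  define U where "U X = D X + scale c (\<Sum>s\<in>Z - X. P (insert s X))" for X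
  have "(\<Sum>x\<in>S. U (S - {x})) = 0" if S: "S \<subseteq> Z" "card S = Suc m" for S
  proof -
    define T where "T = Z - S"
    have fS: "finite S" "finite T" using S Z finite_subset by (auto simp: T_def)
    have T: "T \<subseteq> Z" "card T = Suc m" "Z - T = S"
      using S Z fS by (auto simp: T_def card_Diff_subset)
    have D1: "(\<Sum>x\<in>S. D (S - {x})) = P T - scale c (P S)"
      using R1[OF T(1,2)] T(3) by simp
    have D2: "(\<Sum>x\<in>T. D (T - {x})) = P S - scale c (P T)"
      using R1[OF S] by (simp add: T_def)
    \<comment> \<open>The index s = x gives back S; every other s lies in T and replaces x. Since S
      and T have equal size, the copies of P S can be redistributed over T.\<close>
    have "(\<Sum>x\<in>S. \<Sum>s\<in>Z - (S - {x}). P (insert s (S - {x}))) =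
        (\<Sum>x\<in>S. P S + (\<Sum>s\<in>T. P (insert s (S - {x}))))"
    proof (rule sum.cong[OF refl])
      fix x assume "x \<in> S"
      then have "Z - (S - {x}) = insert x T" "x \<notin> T" using S by (auto simp: T_def)
      then show "(\<Sum>s\<in>Z - (S - {x}). P (insert s (S - {x}))) = P S + (\<Sum>s\<in>T. P (insert s (S - {x})))"
        using \<open>x \<in> S\<close> fS by (simp add: insert_absorb)
    qed
    also have "\<dots> = (\<Sum>s\<in>T. P S + (\<Sum>x\<in>S. P (insert s (S - {x}))))"
      using S T by (simp add: sum.distrib sum_constant_scale sum.swap[of _ T S])
    also have "\<dots> = (\<Sum>s\<in>T. D (T - {s}))"
    \<comment> \<open>For fixed s, the set S and its exchanges are exactly the sets obtained from
      insert s S by deleting one element, and R2 at T - {s} sums P over these.\<close>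
    proof (rule sum.cong[OF refl])
      fix s assume s: "s \<in> T"
      then have "Z - (T - {s}) = insert s S" "s \<notin> S" using S by (auto simp: T_def)
      moreover have "insert s S - {x} = insert s (S - {x})" if "x \<in> S" for x
        using that \<open>s \<notin> S\<close> by auto
      moreover have "D (T - {s}) = (\<Sum>x\<in>Z - (T - {s}). P (Z - (T - {s}) - {x}))"
        using s T by (intro R2) auto
      ultimately show "P S + (\<Sum>x\<in>S. P (insert s (S - {x}))) = D (T - {s})"
        using fS by simp
    qed
    finally have E: "(\<Sum>x\<in>S. \<Sum>s\<in>Z - (S - {x}). P (insert s (S - {x}))) = P S - scale c (P T)"
      using D2 by simp
    have "(\<Sum>x\<in>S. U (S - {x})) = P T - scale c (P S) + scale c (P S - scale c (P T))"
      unfolding U_def sum.distrib D1 scale_sum_right[symmetric] E ..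
    then show ?thesis by (simp add: scale_right_diff_distrib c)
  qed
  then have "U X = 0"
    using Z X by (intro inclusion_sums_injective[of Z m U]) auto
  then show ?thesis by (simp add: U_def eq_neg_iff_add_eq_0)
qed

end

section \<open>Alternating operations on lists\<close>

definition alternating :: "nat \<Rightarrow> 'a set \<Rightarrow> ('a list \<Rightarrow> 'b::ab_group_add) \<Rightarrow> bool" where
  "alternating n V f \<longleftrightarrow>
    (\<forall>xs\<in>nlists n V. \<forall>i<n. \<forall>j<n. i \<noteq> j \<longrightarrow> f (xs[i := xs ! j, j := xs ! i]) = - f xs)"

lemma sorted_list_of_set_split:
  fixes T :: "nat set"
  assumes "finite T" "s \<in> T"
  shows "sorted_list_of_set T =
      sorted_list_of_set {t \<in> T. t < s} @ s # sorted_list_of_set {t \<in> T. s < t}"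
  using assms
  by (intro sorted_distinct_set_unique) (auto simp: sorted_append)

lemma sorted_list_of_set_remove_split:
  fixes T :: "nat set"
  assumes "finite T"
  shows "sorted_list_of_set (T - {s}) =
      sorted_list_of_set {t \<in> T. t < s} @ sorted_list_of_set {t \<in> T. s < t}"
  using assms
  by (intro sorted_distinct_set_unique) (auto simp: sorted_append)

lemma alternating_swap:
  assumes f: "alternating n V f" and xs: "a @ x # b @ y # c \<in> nlists n V"
  shows "f (a @ y # b @ x # c) = - f (a @ x # b @ y # c)"
proof -
  let ?xs = "a @ x # b @ y # c" and ?j = "length a + Suc (length b)"
  have n: "length a < n" "?j < n" using xs by (auto simp: nlists_def)
  have nth: "?xs ! length a = x" "?xs ! ?j = y"
    by (simp_all only: nth_append_length nth_append_length_plus nth_Cons_Suc)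
  have "f (?xs[length a := ?xs ! ?j, ?j := ?xs ! length a]) = - f ?xs"
    using f[unfolded alternating_def, rule_format, OF xs n] by simp
  then show ?thesis
    unfolding nth by (simp add: list_update_append)
qed

text \<open>The fixed increasing order makes an alternating operation a function of index sets; each
  rearrangement then costs a sign that counts smaller or larger indices.\<close>

definition list_of_set :: "(nat \<Rightarrow> 'a) \<Rightarrow> nat set \<Rightarrow> 'a list" where
  "list_of_set z S = map z (sorted_list_of_set S)"

lemma length_list_of_set [simp]: "length (list_of_set z S) = card S"
  by (simp add: list_of_set_def)

lemma list_of_set_in_nlists:
  "finite S \<Longrightarrow> z ` S \<subseteq> V \<Longrightarrow> card S = n \<Longrightarrow> list_of_set z S \<in> nlists n V"
  by (auto simp: list_of_set_def nlists_def)

lemma list_of_set_split: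
  assumes "finite T" "s \<in> T"
  shows "list_of_set z T = list_of_set z {t \<in> T. t < s} @ z s # list_of_set z {t \<in> T. s < t}"
  unfolding list_of_set_def by (subst sorted_list_of_set_split[OF assms]) simp

lemma list_of_set_remove:
  assumes "finite T"
  shows "list_of_set z (T - {s}) = list_of_set z {t \<in> T. t < s} @ list_of_set z {t \<in> T. s < t}"
  unfolding list_of_set_def by (subst sorted_list_of_set_remove_split[OF assms]) simp

text \<open>The position of s in the increasing list is the number of smaller elements of T.\<close>

lemma
  assumes "finite T" "s \<in> T"
  shows omit_nth_list_of_set:
      "omit_nth (card {t \<in> T. t < s}) (list_of_set z T) = list_of_set z (T - {s})"
    and nth_list_of_set: "list_of_set z T ! card {t \<in> T. t < s} = z s"
    and list_update_list_of_set: "(list_of_set z T)[card {t \<in> T. t < s} := u] =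
      list_of_set z {t \<in> T. t < s} @ u # list_of_set z {t \<in> T. s < t}"
  using list_of_set_split[OF assms, of z] list_of_set_remove[OF assms(1), of z s]
  by (simp_all add: omit_nth_def nth_append list_update_append)

text \<open>Turns sums over positions, as in the axioms, into sums over indices: the inverse of the
  increasing enumeration sends s to the number of elements below it.\<close>

lemma sum_lessThan_card:
  fixes T :: "nat set" and g :: "nat \<Rightarrow> 'b::comm_monoid_add"
  assumes "finite T"
  shows "(\<Sum>i<card T. g i) = (\<Sum>s\<in>T. g (card {t \<in> T. t < s}))"
proof -
  have "bij_betw ((!) (sorted_list_of_set T)) {..<card T} T"
    using assms by (intro bij_betw_nth) auto
  moreover have "card {t \<in> T. t < sorted_list_of_set T ! i} = i" if "i < card T" for i
  proof -
    let ?s = "sorted_list_of_set T ! i"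
    have "?s \<in> T" using that assms by (metis nth_mem set_sorted_list_of_set length_sorted_list_of_set)
    from sorted_list_of_set_split[OF assms this]
    have "sorted_list_of_set T ! card {t \<in> T. t < ?s} = ?s" "card {t \<in> T. t < ?s} < card T"
      using assms \<open>?s \<in> T\<close> by (metis length_sorted_list_of_set nth_append_length, intro psubset_card_mono) auto
    then show ?thesis
      using that by (metis distinct_sorted_list_of_set length_sorted_list_of_set nth_eq_iff_index_eq)
  qed
  ultimately show ?thesis
    by (subst sum.reindex_bij_betw[symmetric, of "(!) (sorted_list_of_set T)" "{..<card T}"]) auto
qed

context vector_space_char_0
begin

lemma scale_sign_cong: "even a = even b \<Longrightarrow> scale ((-1) ^ a) x = scale ((-1) ^ b) x"
  by (cases "even a") simp_all

lemma scale_sign_sign: "scale ((-1) ^ a) (scale ((-1) ^ b) x) = scale ((-1) ^ (a + b)) x"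
  by (simp add: power_add)

lemma alternating_move:
  assumes "alternating n V f" "a @ x # b @ c \<in> nlists n V"
  shows "f (a @ x # b @ c) = scale ((-1) ^ length b) (f (a @ b @ x # c))"
  using assms(2)
proof (induction b arbitrary: a)
  case (Cons y b)
  let ?xs = "a @ y # x # b @ c"
  have xs: "?xs \<in> nlists n V" using Cons.prems by (auto simp: nlists_def)
  have "f (a @ x # (y # b) @ c) = - f ((a @ [y]) @ x # b @ c)"
    using alternating_swap[OF assms(1), of a y "[]" x "b @ c"] xs by simp
  also have "\<dots> = - scale ((-1) ^ length b) (f ((a @ [y]) @ b @ x # c))"
    using xs by (subst Cons.IH) simp_all
  finally show ?case by simp
qed simp

text \<open>From the front to its sorted place the new entry passes exactly the smaller indices;
  coming from the end, as in \<open>alternating_snoc_list_of_set\<close>, it passes the larger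
  ones.\<close>

lemma alternating_Cons_list_of_set:
  assumes "alternating n V f" "finite S" "s \<notin> S" "card S + 1 = n" "z ` insert s S \<subseteq> V"
  shows "f (z s # list_of_set z S) =
    scale ((-1) ^ card {t \<in> S. t < s}) (f (list_of_set z (insert s S)))"
proof -
  have eq: "{t \<in> insert s S. t < s} = {t \<in> S. t < s}" "{t \<in> insert s S. s < t} = {t \<in> S. s < t}"
    by auto
  have 1: "list_of_set z S = list_of_set z {t \<in> S. t < s} @ list_of_set z {t \<in> S. s < t}"
    using list_of_set_remove[of S z s] assms by simp
  have 2: "list_of_set z (insert s S) = list_of_set z {t \<in> S. t < s} @ z s # list_of_set z {t \<in> S. s < t}"
    using list_of_set_split[of "insert s S" s z] assms eq by simp
  have "z s # list_of_set z S \<in> nlists n V"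
    using list_of_set_in_nlists[of S z V "card S"] assms by (auto simp: nlists_def)
  then show ?thesis
    using alternating_move[OF assms(1), of "[]" "z s"] by (simp add: 1 2)
qed

lemma alternating_snoc_list_of_set:
  assumes "alternating n V f" "finite S" "s \<notin> S" "card S + 1 = n" "z ` insert s S \<subseteq> V"
  shows "f (list_of_set z S @ [z s]) =
    scale ((-1) ^ card {t \<in> S. s < t}) (f (list_of_set z (insert s S)))"
proof -
  have eq: "{t \<in> insert s S. t < s} = {t \<in> S. t < s}" "{t \<in> insert s S. s < t} = {t \<in> S. s < t}"
    by auto
  have 1: "list_of_set z S = list_of_set z {t \<in> S. t < s} @ list_of_set z {t \<in> S. s < t}"
    using list_of_set_remove[of S z s] assms by simp
  have 2: "list_of_set z (insert s S) = list_of_set z {t \<in> S. t < s} @ z s # list_of_set z {t \<in> S. s < t}"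
    using list_of_set_split[of "insert s S" s z] assms eq by simp
  have "list_of_set z (insert s S) \<in> nlists n V"
    using assms by (intro list_of_set_in_nlists) auto
  then have "f (list_of_set z (insert s S)) =
      scale ((-1) ^ card {t \<in> S. s < t}) (f (list_of_set z S @ [z s]))"
    using alternating_move[OF assms(1), of "list_of_set z {t \<in> S. t < s}" "z s" "list_of_set z {t \<in> S. s < t}" "[]"]
    by (simp add: 1 2)
  then show ?thesis by simp
qed

end

context multilinear_operation
begin

lemma homogeneous_append:
  assumes "a @ u # b \<in> nlists n V"
  shows "br (a @ scale c u # b) = scale c (br (a @ u # b))"
  using homogeneous[OF assms, of "length a" u c] assms by (auto simp: nlists_def)

lemma additive_append:
  assumes "a @ u # b \<in> nlists n V" "v \<in> V"
  shows "br (a @ (u + v) # b) = br (a @ u # b) + br (a @ v # b)"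
  using additive[OF assms(1), of "length a" u v] assms by (auto simp: nlists_def)

lemma zero_append:
  assumes "a @ u # b \<in> nlists n V"
  shows "br (a @ 0 # b) = 0"
  using homogeneous_append[OF assms, of 0] by simp

end

section \<open>The dual of a representation\<close>

text \<open>In the application \<open>a\<close> and \<open>b\<close> count the indices below
  \<open>s\<close> in X and in Z - X, while \<open>x\<close> and \<open>y\<close> are the sums of X
  and of Z - X - {s}.\<close>

lemma parity_bracket:
  fixes a :: nat
  assumes "a + b = s" "b < n" "even (x + y + s) = even (n - 1)"
  shows "even (x + (n - Suc b) + a) = even y"
  using assms by presburger

text \<open>In the application \<open>p\<close> and \<open>h\<close> count the elements of S below
  and above \<open>t\<close>, and \<open>l\<close> those of Z - S below \<open>t\<close>;
  \<open>x\<close> and \<open>y\<close> are the sums of S and of Z - S - {t}, and \<open>m\<close>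
  is n - 1.\<close>

lemma parity_commutator:
  fixes p :: nat
  assumes "p + h = m" "p + l = t" "even (x + y + t) = even m"
  shows "even (x + h + l) = even y"
  using assms by presburger

text \<open>A representation of \<open>(V, br)\<close> on \<open>V\<close> itself, with \<open>pr (xs @ [v])\<close> in the role of \<open>\<rho>(xs) v\<close>. It is the
  adjoint representation if \<open>pr = br\<close>, and left multiplication if \<open>pr\<close> is an n-pre-Lie product
  with commutator \<open>br\<close>.\<close>

locale n_Lie_action = multilinear_operation n scale V pr
  for n :: nat and scale :: "'k::field_char_0 \<Rightarrow> 'a::ab_group_add \<Rightarrow> 'a" and V :: "'a set"
    and pr :: "'a list \<Rightarrow> 'a" +
  fixes br :: "'a list \<Rightarrow> 'a"
  assumes arity: "n \<ge> 2"
    and bracket_closed: "xs \<in> nlists n V \<Longrightarrow> br xs \<in> V"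
    and bracket_alternating: "alternating n V br"
    and action_alternating: "v \<in> V \<Longrightarrow> alternating (n - 1) V (\<lambda>xs. pr (xs @ [v]))"
    and action_commutator: "\<lbrakk>xs \<in> nlists (n - 1) V; ys \<in> nlists (n - 1) V; v \<in> V\<rbrakk>
      \<Longrightarrow> pr (xs @ [pr (ys @ [v])]) =
        (\<Sum>i<n - 1. pr (ys[i := br (xs @ [ys ! i])] @ [v])) + pr (ys @ [pr (xs @ [v])])"
    and action_bracket: "\<lbrakk>xs \<in> nlists n V; ys \<in> nlists (n - 2) V; v \<in> V\<rbrakk>
      \<Longrightarrow> pr (br xs # ys @ [v]) =
        (\<Sum>i<n. scale ((-1) ^ (n - Suc i)) (pr (omit_nth i xs @ [pr (xs ! i # ys @ [v])])))"
begin

section \<open>Sign-free relations for a family of 2(n - 1) vectors\<close>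

context
  fixes z :: "nat \<Rightarrow> 'a" and v :: 'a
  assumes z: "z ` {..<2 * (n - 1)} \<subseteq> V" and v: "v \<in> V"
begin

abbreviation (input) Z where "Z \<equiv> {..<2 * (n - 1)}"

text \<open>The signs turn \<open>action_bracket\<close> and \<open>action_commutator\<close> into the sign-free identities assumed in
  \<open>complementary_identity\<close>.\<close>

definition signed_composite :: "nat set \<Rightarrow> 'a" where
  "signed_composite S = scale ((-1) ^ \<Sum>S)
    (pr (list_of_set z S @ [pr (list_of_set z (Z - S) @ [v])]))"

definition signed_bracket_action :: "nat set \<Rightarrow> 'a" where
  "signed_bracket_action X = scale ((-1) ^ \<Sum>X)
    (pr (br (list_of_set z (Z - X)) # list_of_set z X @ [v]))"

lemma subset_facts:
  assumes "X \<subseteq> Z" "card X = m"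
  shows "finite X" "card (Z - X) = 2 * (n - 1) - m" "list_of_set z X \<in> nlists m V"
    "list_of_set z (Z - X) \<in> nlists (2 * (n - 1) - m) V" "even (\<Sum>X + \<Sum>(Z - X)) = even (n - 1)"
proof -
  show fin: "finite X" using assms(1) finite_subset by blast
  show c: "card (Z - X) = 2 * (n - 1) - m" using assms fin by (simp add: card_Diff_subset)
  show "list_of_set z X \<in> nlists m V"
    using z assms fin by (intro list_of_set_in_nlists) auto
  show "list_of_set z (Z - X) \<in> nlists (2 * (n - 1) - m) V"
    using z c by (intro list_of_set_in_nlists) auto
  \<comment> \<open>The indices form pairs 2k, 2k + 1 with odd sum. Hence complementary sets differ
    in sign by (-1)^(n - 1), which is the origin of the constant \<open>c\<close> of
    \<open>complementary_identity\<close>.\<close>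
  have "even (\<Sum>{..<2 * m}) = even m" for m :: nat
    by (induction m) auto
  moreover have "\<Sum>X + \<Sum>(Z - X) = \<Sum>Z"
    using sum.subset_diff[OF assms(1), of "\<lambda>x. x"] by simp
  ultimately show "even (\<Sum>X + \<Sum>(Z - X)) = even (n - 1)" by simp
qed

lemma card_less_split:
  assumes "X \<subseteq> Z" "s \<in> Z"
  shows "card {t \<in> X. t < s} + card {t \<in> Z - X. t < s} = s"
proof -
  have "{t \<in> X. t < s} \<union> {t \<in> Z - X. t < s} = {..<s}"
    using assms by auto
  moreover have "finite X" using assms(1) finite_subset by blast
  ultimately have "card {..<s} = card {t \<in> X. t < s} + card {t \<in> Z - X. t < s}"
    by (subst card_Un_disjoint[symmetric]) auto
  then show ?thesis by simp
qed

lemma action_Cons: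
  assumes "X \<subseteq> Z" "card X = n - 2" "s \<in> Z - X"
  shows "pr (z s # list_of_set z X @ [v]) =
    scale ((-1) ^ card {t \<in> X. t < s}) (pr (list_of_set z (insert s X) @ [v]))"
proof -
  have "finite X" "card X + 1 = n - 1" "s \<notin> X" "z ` insert s X \<subseteq> V"
    using assms z arity subset_facts(1)[OF assms(1,2)] by auto
  from alternating_Cons_list_of_set[OF action_alternating[OF v] this(1,3,2,4)]
  show ?thesis by simp
qed

text \<open>This is R2 of \<open>complementary_identity\<close>. It comes from
  \<open>action_bracket\<close>, expanded over Z - X; sorting the extracted index s into X costs one
  sign for each smaller element of X.\<close>

lemma signed_bracket_action_eq:
  assumes X: "X \<subseteq> Z" "card X = n - 2"
  shows "signed_bracket_action X = (\<Sum>s\<in>Z - X. signed_composite (Z - X - {s}))"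
proof -
  note facts = subset_facts[OF X]
  let ?T = "Z - X"
  have cT: "card ?T = n" using facts(2) arity by simp
  have T: "list_of_set z ?T \<in> nlists n V" using facts(4) facts(2) cT by simp
  have "signed_bracket_action X = scale ((-1) ^ \<Sum>X) (\<Sum>i<card ?T. scale ((-1) ^ (n - Suc i))
      (pr (omit_nth i (list_of_set z ?T) @ [pr (list_of_set z ?T ! i # list_of_set z X @ [v])])))"
    unfolding signed_bracket_action_def cT using action_bracket[OF T facts(3) v] by simp
  also have "\<dots> = (\<Sum>s\<in>?T. scale ((-1) ^ \<Sum>X) (scale ((-1) ^ (n - Suc (card {t \<in> ?T. t < s})))
      (pr (list_of_set z (?T - {s}) @ [pr (z s # list_of_set z X @ [v])]))))"
    by (subst sum_lessThan_card)
      (simp_all add: scale_sum_right omit_nth_list_of_set nth_list_of_set del: Diff_iff)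
  also have "\<dots> = (\<Sum>s\<in>?T. signed_composite (?T - {s}))"
  proof (rule sum.cong[OF refl])
    fix s assume s: "s \<in> ?T"
    let ?a = "card {t \<in> X. t < s}" and ?b = "card {t \<in> ?T. t < s}"
    have ins: "Z - (?T - {s}) = insert s X" using s X by auto
    have sub: "?T - {s} \<subseteq> Z" "card (?T - {s}) = n - 1" "insert s X \<subseteq> Z" "card (insert s X) = n - 1"
      using s cT X facts(1) arity by auto
    have l: "list_of_set z (?T - {s}) \<in> nlists (n - 1) V" "list_of_set z (insert s X) \<in> nlists (n - 1) V"
      using subset_facts(3)[OF sub(1,2)] subset_facts(3)[OF sub(3,4)] by simp_all
    have "list_of_set z (insert s X) @ [v] \<in> nlists n V"
      using l(2) v arity by (auto simp: nlists_def)
    then have "list_of_set z (?T - {s}) @ [pr (list_of_set z (insert s X) @ [v])] \<in> nlists n V"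
      using l(1) closed arity by (auto simp: nlists_def)
    then have "pr (list_of_set z (?T - {s}) @ [pr (z s # list_of_set z X @ [v])]) =
        scale ((-1) ^ ?a) (pr (list_of_set z (?T - {s}) @ [pr (list_of_set z (insert s X) @ [v])]))"
      unfolding action_Cons[OF X s] by (rule homogeneous_append)
    moreover have "?b < card ?T"
      using s by (intro psubset_card_mono) auto
    then have "?b < n" unfolding cT .
    moreover have "?a + ?b = s" using card_less_split[of X s] X s by auto
    moreover have "\<Sum>(?T - {s}) + s = \<Sum>?T"
      using s by (simp add: sum.remove)
    then have "even (\<Sum>X + \<Sum>(?T - {s}) + s) = even (n - 1)" using facts(5) by (metis add.assoc)
    ultimately have "even (\<Sum>X + (n - Suc ?b) + ?a) = even (\<Sum>(?T - {s}))"
      by (intro parity_bracket)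
    then show "scale ((-1) ^ \<Sum>X) (scale ((-1) ^ (n - Suc ?b))
      (pr (list_of_set z (?T - {s}) @ [pr (z s # list_of_set z X @ [v])]))) = signed_composite (?T - {s})"
      unfolding signed_composite_def ins
        \<open>pr (list_of_set z (?T - {s}) @ [pr (z s # list_of_set z X @ [v])]) = _\<close> scale_sign_sign
      by (intro scale_sign_cong) (simp only: add.assoc)
  qed
  finally show ?thesis .
qed

text \<open>This is R1 of \<open>complementary_identity\<close>, with c = (-1)^(n - 1). It comes
  from \<open>action_commutator\<close>.\<close>

lemma signed_composite_commutator:
  assumes S: "S \<subseteq> Z" "card S = n - 1"
  shows "signed_composite S - scale ((-1) ^ (n - 1)) (signed_composite (Z - S)) =
    (\<Sum>t\<in>Z - S. signed_bracket_action (Z - S - {t}))"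
proof -
  let ?T = "Z - S"
  note facts = subset_facts[OF S]
  have cT: "card ?T = n - 1" using facts(2) arity by simp
  have ZT: "Z - ?T = S" using S by auto
  have T: "list_of_set z ?T \<in> nlists (n - 1) V" using facts(4) facts(2) cT by simp
  let ?PS = "pr (list_of_set z S @ [pr (list_of_set z ?T @ [v])])"
  let ?PT = "pr (list_of_set z ?T @ [pr (list_of_set z S @ [v])])"
  have "scale ((-1) ^ (n - 1)) (signed_composite ?T) = scale ((-1) ^ \<Sum>S) ?PT"
    unfolding signed_composite_def ZT scale_sign_sign
    using facts(5) by (intro scale_sign_cong) auto
  then have "signed_composite S - scale ((-1) ^ (n - 1)) (signed_composite ?T) =
      scale ((-1) ^ \<Sum>S) (?PS - ?PT)"
    by (simp add: signed_composite_def scale_right_diff_distrib)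
  also have "?PS - ?PT = (\<Sum>i<card ?T. pr ((list_of_set z ?T)[i := br (list_of_set z S @ [list_of_set z ?T ! i])] @ [v]))"
    using action_commutator[OF facts(3) T v] cT by simp
  also have "\<dots> = (\<Sum>t\<in>?T. pr ((list_of_set z {r \<in> ?T. r < t} @ br (list_of_set z S @ [z t]) #
      list_of_set z {r \<in> ?T. t < r}) @ [v]))"
    by (subst sum_lessThan_card)
      (simp_all add: nth_list_of_set list_update_list_of_set del: Diff_iff)
  also have "scale ((-1) ^ \<Sum>S) \<dots> = (\<Sum>t\<in>?T. signed_bracket_action (?T - {t}))"
    unfolding scale_sum_right
  proof (rule sum.cong[OF refl])
    fix t assume t: "t \<in> ?T"
    let ?L = "{r \<in> ?T. r < t}" and ?G = "{r \<in> ?T. t < r}" and ?H = "{r \<in> S. t < r}"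
    let ?u = "br (list_of_set z (insert t S))"
    have ZTt: "Z - (?T - {t}) = insert t S" using t S by auto
    have sub: "?T - {t} \<subseteq> Z" "card (?T - {t}) = n - 2" "insert t S \<subseteq> Z" "card (insert t S) = n"
      using t cT S facts(1) arity by auto
    have u: "?u \<in> V"
      using subset_facts(3)[OF sub(3,4)] bracket_closed by simp
    have "list_of_set z (?T - {t}) \<in> nlists (n - 2) V"
      using subset_facts(3)[OF sub(1,2)] by simp
    then have l: "list_of_set z ?L @ ?u # list_of_set z ?G \<in> nlists (n - 1) V"
      unfolding list_of_set_remove[OF finite_Diff[OF finite_lessThan]]
      using u arity by (auto simp: nlists_def)
    \<comment> \<open>Two sorting signs arise: t passes the larger elements of S inside the bracket,
      and then the bracket itself moves to the front past the elements of Z - S below t.\<close>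
    have "br (list_of_set z S @ [z t]) = scale ((-1) ^ card ?H) ?u"
      using t S facts arity z
      by (intro alternating_snoc_list_of_set[OF bracket_alternating]) auto
    then have "pr ((list_of_set z ?L @ br (list_of_set z S @ [z t]) # list_of_set z ?G) @ [v]) =
        scale ((-1) ^ card ?H) (pr ((list_of_set z ?L @ ?u # list_of_set z ?G) @ [v]))"
      using homogeneous_append[of "list_of_set z ?L" ?u "list_of_set z ?G @ [v]" "(-1) ^ card ?H"] l v arity
      by (simp add: nlists_def)
    also have "pr ((list_of_set z ?L @ ?u # list_of_set z ?G) @ [v]) =
        scale ((-1) ^ card ?L) (pr ((?u # list_of_set z ?L @ list_of_set z ?G) @ [v]))"
      using alternating_move[OF action_alternating[OF v], of "[]" ?u "list_of_set z ?L" "list_of_set z ?G"] l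
      by (simp add: nlists_def scale_sign_sign)
    also have "list_of_set z ?L @ list_of_set z ?G = list_of_set z (?T - {t})"
      by (simp add: list_of_set_remove)
    finally have *: "pr ((list_of_set z ?L @ br (list_of_set z S @ [z t]) # list_of_set z ?G) @ [v]) =
      scale ((-1) ^ card ?H) (scale ((-1) ^ card ?L) (pr (?u # list_of_set z (?T - {t}) @ [v])))" by simp
    have split: "{r \<in> S. r < t} \<union> ?H = S" using t by (auto simp: not_less le_less)
    have "card ({r \<in> S. r < t} \<union> ?H) = card {r \<in> S. r < t} + card ?H"
      by (rule card_Un_disjoint) (use facts(1) in auto)
    then have "card {r \<in> S. r < t} + card ?H = n - 1"
      unfolding split S(2) by (rule sym)
    moreover have "card {r \<in> S. r < t} + card ?L = t" using card_less_split[of S t] S t by auto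
    moreover have "\<Sum>(?T - {t}) + t = \<Sum>?T"
      using t by (simp add: sum.remove)
    then have "even (\<Sum>S + \<Sum>(?T - {t}) + t) = even (n - 1)" using facts(5) by (metis add.assoc)
    ultimately have "even (\<Sum>S + card ?H + card ?L) = even (\<Sum>(?T - {t}))"
      by (rule parity_commutator)
    then show "scale ((-1) ^ \<Sum>S) (pr ((list_of_set z ?L @ br (list_of_set z S @ [z t]) #
      list_of_set z ?G) @ [v])) = signed_bracket_action (?T - {t})"
      unfolding * signed_bracket_action_def ZTt scale_sign_sign
      by (intro scale_sign_cong) (simp only: add.assoc)
  qed
  finally show ?thesis .
qed

lemma signed_bracket_action_dual:
  assumes "X \<subseteq> Z" "card X = n - 2"
  shows "signed_bracket_action X =
    - scale ((-1) ^ (n - 1)) (\<Sum>s\<in>Z - X. signed_composite (insert s X))"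
proof (rule complementary_identity[of Z "n - 2"])
  show "card Z = 2 * Suc (n - 2)" using arity by simp
  show "(-1 :: 'k) ^ (n - 1) * (-1) ^ (n - 1) = 1"
    by (simp flip: power_mult_distrib)
  show "signed_composite S - scale ((-1) ^ (n - 1)) (signed_composite (Z - S)) =
      (\<Sum>t\<in>Z - S. signed_bracket_action (Z - S - {t}))" if "S \<subseteq> Z" "card S = Suc (n - 2)" for S
    using that arity by (intro signed_composite_commutator) auto
qed (use assms signed_bracket_action_eq in auto)

end

text \<open>The dual maps \<open>\<rho>\<^sup>*(xs) = -\<rho>(xs)\<^sup>T\<close> satisfy the analogue of \<open>action_bracket\<close>: this is that
  analogue, transposed.\<close>

lemma dual_action_bracket:
  assumes xs: "xs \<in> nlists n V" and ys: "ys \<in> nlists (n - 2) V" and v: "v \<in> V"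
  shows "pr (br xs # ys @ [v]) =
    - (\<Sum>i<n. scale ((-1) ^ (n - Suc i)) (pr (xs ! i # ys @ [pr (omit_nth i xs @ [v])])))"
proof -
  define z where "z = nth (xs @ ys)"
  have len: "length xs = n" "length ys = n - 2" using xs ys by (auto simp: nlists_def)
  have "z i \<in> V" if "i < 2 * (n - 1)" for i
  proof -
    have "(xs @ ys) ! i \<in> set (xs @ ys)" using that len arity by (intro nth_mem) auto
    then show ?thesis using xs ys by (auto simp: z_def nlists_def)
  qed
  then have z: "z ` {..<2 * (n - 1)} \<subseteq> V" by auto
  \<comment> \<open>The first n indices carry \<open>xs\<close> and the remaining n - 2 carry
    \<open>ys\<close>, so X indexes the vectors standing beside the bracket.\<close>
  let ?Z = "{..<2 * (n - 1)}" and ?X = "{n..<2 * (n - 1)}"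
  have X: "?X \<subseteq> ?Z" "card ?X = n - 2" and ZX: "?Z - ?X = {..<n}" using arity by auto
  have lX: "list_of_set z ?X = ys"
    unfolding list_of_set_def sorted_list_of_set_range
    using len arity by (intro nth_equalityI) (auto simp: z_def nth_append)
  have "sorted_list_of_set {..<n} = [0..<n]"
    by (simp add: lessThan_atLeast0)
  then have lZ: "list_of_set z {..<n} = xs"
    unfolding list_of_set_def using len by (intro nth_equalityI) (auto simp: z_def nth_append)
  have P: "signed_composite z v (insert i ?X) =
      scale ((-1) ^ (i + \<Sum>?X)) (pr (xs ! i # ys @ [pr (omit_nth i xs @ [v])]))" if i: "i < n" for i
  proof -
    have e: "{t \<in> insert i ?X. t < i} = {}" "{t \<in> insert i ?X. i < t} = ?X" "{t \<in> {..<n}. t < i} = {..<i}"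
      using i by auto
    have "list_of_set z (insert i ?X) = z i # list_of_set z ?X"
      using list_of_set_split[of "insert i ?X" i z] unfolding e by (simp add: list_of_set_def)
    moreover have "?Z - insert i ?X = {..<n} - {i}" using ZX by auto
    moreover have "list_of_set z ({..<n} - {i}) = omit_nth i xs"
      using omit_nth_list_of_set[of "{..<n}" i z] i unfolding e by (simp add: lZ)
    moreover have "z i = xs ! i" using i len by (simp add: z_def nth_append)
    moreover have "\<Sum>(insert i ?X) = i + \<Sum>?X" using i by simp
    ultimately show ?thesis
      unfolding signed_composite_def[OF z v] by (simp only: lX append_Cons)
  qed
  have "scale ((-1) ^ \<Sum>?X) (pr (br xs # ys @ [v])) = signed_bracket_action z v ?X"
    unfolding signed_bracket_action_def[OF z v] ZX lZ lX ..
  also have "\<dots> = - scale ((-1) ^ (n - 1)) (\<Sum>i<n. signed_composite z v (insert i ?X))"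
    using signed_bracket_action_dual[OF z v X] unfolding ZX .
  also have "\<dots> = scale ((-1) ^ \<Sum>?X)
      (- (\<Sum>i<n. scale ((-1) ^ (n - Suc i)) (pr (xs ! i # ys @ [pr (omit_nth i xs @ [v])]))))"
    unfolding scale_sum_right scale_minus_right
  proof (intro arg_cong[of _ _ uminus] sum.cong[OF refl])
    fix i assume "i \<in> {..<n}"
    then have "i < n" by simp
    then show "scale ((-1) ^ (n - 1)) (signed_composite z v (insert i ?X)) =
      scale ((-1) ^ \<Sum>?X) (scale ((-1) ^ (n - Suc i)) (pr (xs ! i # ys @ [pr (omit_nth i xs @ [v])])))"
      unfolding P[OF \<open>i < n\<close>] scale_sign_sign by (intro scale_sign_cong) presburger
  qed
  \<comment> \<open>Applying the common sign a second time turns it into 1 on both sides.\<close>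
  finally have "scale ((-1) ^ \<Sum>?X) (scale ((-1) ^ \<Sum>?X) (pr (br xs # ys @ [v]))) =
      scale ((-1) ^ \<Sum>?X) (scale ((-1) ^ \<Sum>?X)
      (- (\<Sum>i<n. scale ((-1) ^ (n - Suc i)) (pr (xs ! i # ys @ [pr (omit_nth i xs @ [v])])))))"
    by simp
  then show ?thesis unfolding scale_sign_sign by simp
qed

end

section \<open>The space \<open>\<hh> \<oplus> \<hh>\<^sup>*\<close>\<close>

lemma sum_fun_apply: "(\<Sum>i\<in>I. f i) x = (\<Sum>i\<in>I. f i x)"
  by (induction I rule: infinite_finite_induct) simp_all

lemma fst_double_scale [simp]: "fst (double_scale scale c p) = scale c (fst p)"
  and snd_double_scale [simp]: "snd (double_scale scale c p) y = c * snd p y"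
  by (simp_all add: double_scale_def case_prod_beta)

lemma double_form_eq: "double_form p q = snd p (fst q) - snd q (fst p)"
  by (simp add: double_form_def case_prod_beta)

context vector_space_char_0
begin

lemma mem_dual_carrier_iff:
  "f \<in> dual_carrier scale \<longleftrightarrow> (\<forall>x y. f (x + y) = f x + f y) \<and> (\<forall>c x. f (scale c x) = c * f x)"
proof -
  have "vector_space ((*) :: 'k \<Rightarrow> 'k \<Rightarrow> 'k)"
    by unfold_locales (simp_all add: algebra_simps)
  then show ?thesis
    by (simp add: dual_carrier_def Vector_Spaces.linear_def module_hom_def module_hom_axioms_def
        module_iff_vector_space vector_space_axioms)
qed

lemma mem_double_carrier_iff: "p \<in> double_carrier scale \<longleftrightarrow> snd p \<in> dual_carrier scale"
  by (cases p) (simp add: double_carrier_def)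

lemma dual_add: "f \<in> dual_carrier scale \<Longrightarrow> f (x + y) = f x + f y"
  and dual_scale: "f \<in> dual_carrier scale \<Longrightarrow> f (scale c x) = c * f x"
  by (simp_all add: mem_dual_carrier_iff)

lemma dual_zero: "f \<in> dual_carrier scale \<Longrightarrow> f 0 = 0"
  using dual_scale[of f 0 0] by simp

lemma dual_minus: "f \<in> dual_carrier scale \<Longrightarrow> f (- x) = - f x"
  using dual_scale[of f "-1" x] by simp

lemma dual_sum: "f \<in> dual_carrier scale \<Longrightarrow> f (\<Sum>i\<in>I. g i) = (\<Sum>i\<in>I. f (g i))"
  by (induction I rule: infinite_finite_induct) (simp_all add: dual_add dual_zero)

lemma zero_in_dual_carrier: "0 \<in> dual_carrier scale"
  and add_in_dual_carrier:
    "f \<in> dual_carrier scale \<Longrightarrow> g \<in> dual_carrier scale \<Longrightarrow> f + g \<in> dual_carrier scale"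
  and scale_in_dual_carrier: "f \<in> dual_carrier scale \<Longrightarrow> (\<lambda>y. c * f y) \<in> dual_carrier scale"
  by (auto simp: mem_dual_carrier_iff algebra_simps)

lemma vector_space_double: "vector_space (double_scale scale)"
  by unfold_locales (auto simp: double_scale_def fun_eq_iff algebra_simps)

lemma subspace_double:
  assumes "module.subspace scale U" "0 \<in> F"
    and "\<And>f g. f \<in> F \<Longrightarrow> g \<in> F \<Longrightarrow> f + g \<in> F"
    and "\<And>c f. f \<in> F \<Longrightarrow> (\<lambda>y. c * f y) \<in> F"
  shows "module.subspace (double_scale scale) (U \<times> F)"
proof -
  interpret double: vector_space "double_scale scale" by (rule vector_space_double)
  show ?thesis
    using assms by (auto simp: double.subspace_def subspace_def double_scale_def zero_prod_def)
qed

lemma subspace_double_carrier: "module.subspace (double_scale scale) (double_carrier scale)"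
  and subspace_double_left: "module.subspace (double_scale scale) (UNIV \<times> {0})"
  and subspace_double_right: "module.subspace (double_scale scale) ({0} \<times> dual_carrier scale)"
proof -
  show "module.subspace (double_scale scale) (double_carrier scale)"
    unfolding double_carrier_def
    by (intro subspace_double subspace_UNIV zero_in_dual_carrier add_in_dual_carrier scale_in_dual_carrier)
  show "module.subspace (double_scale scale) (UNIV \<times> {0})"
    by (intro subspace_double subspace_UNIV) (simp_all add: zero_fun_def)
  show "module.subspace (double_scale scale) ({0} \<times> dual_carrier scale)"
    by (intro subspace_double subspace_single_0 zero_in_dual_carrier add_in_dual_carrier scale_in_dual_carrier)
qed

end

section \<open>Bases, dual bases and reflexivity\<close>

locale fin_dim_UNIV = fin_dim_space scale UNIV
  for scale :: "'k::field_char_0 \<Rightarrow> 'a::ab_group_add \<Rightarrow> 'a"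
begin

lemma finite_basis_exists:
  obtains b where "finite b" "independent b" "span b = UNIV"
proof -
  from finitely_spanned obtain S where S: "finite S" "span S = UNIV" by auto
  obtain b where b: "b \<subseteq> S" "independent b" "S \<subseteq> span b"
    using maximal_independent_subset by blast
  then have "span b = UNIV"
    using S(2) span_mono[OF b(3)] top_le unfolding span_span by metis
  moreover have "finite b" using b S finite_subset by blast
  ultimately show thesis using b that by blast
qed

definition basis :: "'a set" where
  "basis = (SOME b. finite b \<and> independent b \<and> span b = UNIV)"

lemma finite_basis: "finite basis" and independent_basis: "independent basis" and span_basis: "span basis = UNIV"
  using someI_ex[of "\<lambda>b. finite b \<and> independent b \<and> span b = UNIV"] finite_basis_exists
  unfolding basis_def by blast+

definition coord :: "'a \<Rightarrow> 'a \<Rightarrow> 'k" where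
  "coord e x = representation basis x e"

lemma coord_in_dual: "coord e \<in> dual_carrier scale"
  unfolding mem_dual_carrier_iff coord_def
  by (simp add: representation_add representation_scale independent_basis span_basis)

lemma sum_coord: "(\<Sum>e\<in>basis. scale (coord e x) e) = x"
  unfolding coord_def by (rule sum_representation_eq) (simp_all add: independent_basis span_basis finite_basis)

lemma dual_eq_sum_coord: "f \<in> dual_carrier scale \<Longrightarrow> f = (\<Sum>e\<in>basis. (\<lambda>x. f e * coord e x))"
proof
  fix x assume f: "f \<in> dual_carrier scale"
  have "f x = f (\<Sum>e\<in>basis. scale (coord e x) e)" by (simp add: sum_coord)
  also have "\<dots> = (\<Sum>e\<in>basis. f e * coord e x)"
    by (simp add: dual_sum[OF f] dual_scale[OF f] mult.commute)
  finally show "f x = (\<Sum>e\<in>basis. (\<lambda>x. f e * coord e x)) x"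
    by (simp add: sum_fun_apply)
qed

lemma dual_separates:
  assumes "\<And>f. f \<in> dual_carrier scale \<Longrightarrow> f x = f y"
  shows "x = y"
proof -
  have "(\<Sum>e\<in>basis. scale (coord e x) e) = (\<Sum>e\<in>basis. scale (coord e y) e)"
    using assms[OF coord_in_dual] by simp
  then show ?thesis by (simp add: sum_coord)
qed

text \<open>Reflexivity: the vector has the values of \<open>\<psi>\<close> on the dual basis as its
  coordinates. As \<open>\<psi>\<close> is linear on the dual only, pulling it through a sum
  requires the partial sums to lie in the dual.\<close>

lemma double_dual_surjective:
  assumes add: "\<And>f g. f \<in> dual_carrier scale \<Longrightarrow> g \<in> dual_carrier scale \<Longrightarrow> \<psi> (f + g) = \<psi> f + \<psi> g"
    and scale: "\<And>c f. f \<in> dual_carrier scale \<Longrightarrow> \<psi> (\<lambda>y. c * f y) = c * \<psi> f"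
  shows "\<exists>x. \<forall>f\<in>dual_carrier scale. f x = \<psi> f"
proof (intro exI ballI)
  fix f assume f: "f \<in> dual_carrier scale"
  have zero: "\<psi> 0 = 0"
    using scale[OF zero_in_dual_carrier, of 0] by (simp add: zero_fun_def)
  have in_dual: "(\<Sum>e\<in>E. (\<lambda>x. f e * coord e x)) \<in> dual_carrier scale" for E
    by (induction E rule: infinite_finite_induct)
      (simp_all only: sum.infinite sum.empty sum.insert not_False_eq_True zero_in_dual_carrier
        add_in_dual_carrier scale_in_dual_carrier coord_in_dual)
  have "\<psi> (\<Sum>e\<in>E. (\<lambda>x. f e * coord e x)) = (\<Sum>e\<in>E. f e * \<psi> (coord e))" for E
    by (induction E rule: infinite_finite_induct)
      (simp_all only: sum.infinite sum.empty sum.insert not_False_eq_True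
        zero add scale in_dual coord_in_dual scale_in_dual_carrier)
  from this[of basis] have "\<psi> f = (\<Sum>e\<in>basis. f e * \<psi> (coord e))"
    using dual_eq_sum_coord[OF f] by simp
  then show "f (\<Sum>e\<in>basis. scale (\<psi> (coord e)) e) = \<psi> f"
    by (simp add: dual_sum[OF f] dual_scale[OF f] mult.commute)
qed

lemma fin_dim_double: "fin_dim_space (double_scale scale) (double_carrier scale)"
proof -
  interpret double: vector_space "double_scale scale" by (rule vector_space_double)
  let ?S = "(\<lambda>e. (e, 0)) ` basis \<union> (\<lambda>e. (0, coord e)) ` basis"
  show ?thesis
  proof unfold_locales
    show "double.subspace (double_carrier scale)" by (rule subspace_double_carrier)
    have "p \<in> double.span ?S" if p: "p \<in> double_carrier scale" for p
    proof -
      have "snd p = (\<Sum>e\<in>basis. (\<lambda>x. snd p e * coord e x))"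
        using p by (intro dual_eq_sum_coord) (simp add: mem_double_carrier_iff)
      then have "p = (\<Sum>e\<in>basis. double_scale scale (coord e (fst p)) (e, 0)) +
          (\<Sum>e\<in>basis. double_scale scale (snd p e) (0, coord e))"
        by (simp add: prod_eq_iff fst_sum snd_sum double_scale_def sum_coord zero_fun_def[symmetric])
      also have "\<dots> \<in> double.span ?S"
        by (intro double.span_add double.span_sum double.span_scale double.span_base) auto
      finally show ?thesis .
    qed
    moreover have "finite ?S" using finite_basis by simp
    moreover have "?S \<subseteq> double_carrier scale"
      by (auto simp: mem_double_carrier_iff zero_in_dual_carrier coord_in_dual)
    ultimately show "\<exists>S. finite S \<and> S \<subseteq> double_carrier scale \<and> double_carrier scale \<subseteq> double.span S"
      by blast
  qed
qed

end

section \<open>From phase spaces to n-pre-Lie algebras\<close>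

text \<open>Only skewness in the first n - 1 arguments is assumed, so that this serves both n-Lie
  brackets and n-pre-Lie products.\<close>

lemma alternating_snoc:
  assumes "\<And>xs i j. xs \<in> nlists n V \<Longrightarrow> i < n - 1 \<Longrightarrow> j < n - 1 \<Longrightarrow> i \<noteq> j \<Longrightarrow>
      f (xs[i := xs ! j, j := xs ! i]) = - f xs"
    and "n \<ge> 1" "v \<in> V"
  shows "alternating (n - 1) V (\<lambda>xs. f (xs @ [v]))"
  unfolding alternating_def
proof (intro ballI allI impI)
  fix xs i j assume xs: "xs \<in> nlists (n - 1) V" and ij: "i < n - 1" "j < n - 1" "i \<noteq> j"
  have "xs @ [v] \<in> nlists n V" using xs assms(2,3) by (auto simp: nlists_def)
  from assms(1)[OF this ij] show "f (xs[i := xs ! j, j := xs ! i] @ [v]) = - f (xs @ [v])"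
    using xs ij by (auto simp: nlists_def list_update_append nth_append)
qed

context n_Lie_algebra
begin

lemma bracket_is_alternating: "alternating n V br"
  unfolding alternating_def using skew by blast

text \<open>Both action axioms are the fundamental identity: \<open>action_commutator\<close> with
  the last summand split off, \<open>action_bracket\<close> with v and \<open>ys\<close> as the
  acting arguments.\<close>

lemma adjoint_action:
  assumes n: "n \<ge> 2"
  shows "n_Lie_action n scale V br br"
proof unfold_locales
  show "alternating (n - 1) V (\<lambda>xs. br (xs @ [v]))" if "v \<in> V" for v
    using n that by (intro alternating_snoc skew) auto
next
  fix xs ys v
  assume xs: "xs \<in> nlists (n - 1) V" and ys: "ys \<in> nlists (n - 1) V" and v: "v \<in> V"
  have m: "n = Suc (n - 1)" and len: "length ys = n - 1" using n ys by (auto simp: nlists_def)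
  have "ys @ [v] \<in> nlists n V" using n ys v by (auto simp: nlists_def)
  from fundamental_identity[OF xs this]
  show "br (xs @ [br (ys @ [v])]) =
      (\<Sum>i<n - 1. br (ys[i := br (xs @ [ys ! i])] @ [v])) + br (ys @ [br (xs @ [v])])"
    by (subst (asm) m, subst (asm) sum.lessThan_Suc)
      (simp add: len list_update_append nth_append)
next
  fix xs ys v
  assume xs: "xs \<in> nlists n V" and ys: "ys \<in> nlists (n - 2) V" and v: "v \<in> V"
  have l: "br xs # ys @ [v] \<in> nlists n V" "v # ys \<in> nlists (n - 1) V"
    using n xs ys v closed by (auto simp: nlists_def)
  \<comment> \<open>Exchanging v with the inner bracket puts the bracket last, where the fundamental
    identity applies; exchanging v back in each summand cancels the minus sign.\<close>
  have "br (br xs # ys @ [v]) = - br ((v # ys) @ [br xs])"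
    using alternating_swap[OF bracket_is_alternating, of "[]" "br xs" ys v "[]"] l by simp
  also have "\<dots> = (\<Sum>i<n. - br (xs[i := br (v # ys @ [xs ! i])]))"
    using fundamental_identity[OF l(2) xs] by (simp add: sum_negf)
  also have "\<dots> = (\<Sum>i<n. scale ((-1) ^ (n - Suc i)) (br (omit_nth i xs @ [br (xs ! i # ys @ [v])])))"
  proof (rule sum.cong[OF refl])
    fix i assume "i \<in> {..<n}"
    then have i: "i < n" "i < length xs" using xs by (auto simp: nlists_def)
    have "xs ! i \<in> V" using xs i by (auto simp: nlists_def)
    let ?u = "br (xs ! i # ys @ [v])" and ?w = "br (v # ys @ [xs ! i])"
    have uv: "xs ! i # ys @ [v] \<in> nlists n V" "v # ys @ [xs ! i] \<in> nlists n V"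
      using n ys v \<open>xs ! i \<in> V\<close> by (auto simp: nlists_def)
    have w: "?w = - ?u"
      using alternating_swap[OF bracket_is_alternating, of "[]" "xs ! i" ys v "[]"] uv by simp
    have "take i xs @ ?w # drop (Suc i) xs = xs[i := ?w]"
      using i by (simp add: upd_conv_take_nth_drop)
    moreover from this have "take i xs @ ?w # drop (Suc i) xs \<in> nlists n V"
      using xs closed[OF uv(2)] by simp
    ultimately have "br (xs[i := ?w]) = scale ((-1) ^ (n - Suc i)) (br (omit_nth i xs @ [?w]))"
      using alternating_move[OF bracket_is_alternating, of "take i xs" ?w "drop (Suc i) xs" "[]"] xs
      by (simp add: omit_nth_def nlists_def)
    moreover have "omit_nth i xs @ [?u] \<in> nlists n V"
      using xs i closed[OF uv(1)] by (auto simp: omit_nth_def nlists_def dest!: in_set_takeD in_set_dropD)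
    then have "br (omit_nth i xs @ [?w]) = - br (omit_nth i xs @ [?u])"
      using homogeneous_append[of "omit_nth i xs" ?u "[]" "-1"] by (simp add: w)
    ultimately show "- br (xs[i := ?w]) = scale ((-1) ^ (n - Suc i)) (br (omit_nth i xs @ [?u]))"
      by simp
  qed
  finally show "br (br xs # ys @ [v]) =
    (\<Sum>i<n. scale ((-1) ^ (n - Suc i)) (br (omit_nth i xs @ [br (xs ! i # ys @ [v])])))" .
qed (use n closed bracket_is_alternating in auto)

end

lemma map_omit_nth: "map f (omit_nth i xs) = omit_nth i (map f xs)"
  by (simp add: omit_nth_def take_map drop_map)

section \<open>The product read off from the canonical form\<close>

context n_Lie_algebra
begin

context
  fixes br'
  assumes phase: "phase_space n scale br br'" and UNIV: "V = UNIV" and n: "n \<ge> 2"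
begin

interpretation fin_dim_UNIV scale
  using fin_dim_space_axioms UNIV by (simp add: fin_dim_UNIV_def)

interpretation double: symplectic_n_Lie_algebra n "double_scale scale" "double_carrier scale" br' double_form
  using phase by (simp add: phase_space_def)

interpretation double: n_Lie_action n "double_scale scale" "double_carrier scale" br' br'
  using n by (rule double.adjoint_action)

abbreviation (input) emb :: "'a \<Rightarrow> 'a \<times> ('a \<Rightarrow> 'k)" where "emb x \<equiv> (x, 0)"

lemma emb_in_double: "emb x \<in> double_carrier scale"
  by (simp add: mem_double_carrier_iff zero_in_dual_carrier)

lemma bracket_emb: "length xs = n \<Longrightarrow> br' (map emb xs) = emb (br xs)"
  using phase by (simp add: phase_space_def in_nlists_UNIV)

lemma snoc_in_double:
  "length xs = n - 1 \<Longrightarrow> u \<in> double_carrier scale \<Longrightarrow> map emb xs @ [u] \<in> nlists n (double_carrier scale)"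
  using n emb_in_double by (auto simp: nlists_def)

lemma bracket_snoc_in_dual:
  assumes "length xs = n - 1" "u \<in> double_carrier scale"
  shows "snd (br' (map emb xs @ [u])) \<in> dual_carrier scale"
  using double.closed[OF snoc_in_double[OF assms]] by (simp add: mem_double_carrier_iff)

text \<open>Only elements \<open>(0, f)\<close> are used as tests, so that the condition is a
  functional on the dual and reflexivity supplies the vector.\<close>

definition product_of_form :: "'a list \<Rightarrow> 'a" where
  "product_of_form xs = (SOME p. \<forall>f\<in>dual_carrier scale.
    f p = - snd (br' (map emb (butlast xs) @ [(0, f)])) (last xs))"

text \<open>In terms of the form, \<open>B({x\<^sub>1, \<dots>, x\<^sub>n}, u) = - B(x\<^sub>n, [x\<^sub>1, \<dots>, x\<^bsub>n-1\<^esub>, u])\<close>.\<close>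

lemma product_of_form:
  assumes xs: "length xs = n - 1" and u: "u \<in> double_carrier scale"
  shows "snd u (product_of_form (xs @ [v])) = - snd (br' (map emb xs @ [u])) v"
proof -
  let ?\<psi> = "\<lambda>f. - snd (br' (map emb xs @ [(0, f)])) v"
  have in_double: "(0, f) \<in> double_carrier scale" if "f \<in> dual_carrier scale" for f
    using that by (simp add: mem_double_carrier_iff)
  have "\<exists>p. \<forall>f\<in>dual_carrier scale. f p = ?\<psi> f"
  proof (rule double_dual_surjective)
    fix f g assume f: "f \<in> dual_carrier scale" and g: "g \<in> dual_carrier scale"
    have "br' (map emb xs @ [(0, f) + (0, g)]) = br' (map emb xs @ [(0, f)]) + br' (map emb xs @ [(0, g)])"
      using snoc_in_double[OF xs in_double[OF f]] in_double[OF g]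
      by (intro double.additive_append)
    then show "?\<psi> (f + g) = ?\<psi> f + ?\<psi> g" by simp
  next
    fix c f assume f: "f \<in> dual_carrier scale"
    have "br' (map emb xs @ [double_scale scale c (0, f)]) =
        double_scale scale c (br' (map emb xs @ [(0, f)]))"
      using snoc_in_double[OF xs in_double[OF f]] by (intro double.homogeneous_append)
    moreover have "double_scale scale c (0, f) = (0, \<lambda>y. c * f y)"
      by (simp add: double_scale_def)
    ultimately show "?\<psi> (\<lambda>y. c * f y) = c * ?\<psi> f" by simp
  qed
  then have p: "f (product_of_form (xs @ [v])) = ?\<psi> f" if "f \<in> dual_carrier scale" for f
    unfolding product_of_form_def butlast_snoc last_snoc
    using someI_ex[of "\<lambda>p. \<forall>f\<in>dual_carrier scale. f p = ?\<psi> f"] that by blast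
  have f: "snd u \<in> dual_carrier scale" using u by (simp add: mem_double_carrier_iff)
  \<comment> \<open>The vector part of u contributes a bracket inside the subalgebra of vectors,
    whose functional part is 0; hence the tests \<open>(0, f)\<close> determine the case of general
    u.\<close>
  have "br' (map emb xs @ [emb (fst u) + (0, snd u)]) =
      br' (map emb xs @ [emb (fst u)]) + br' (map emb xs @ [(0, snd u)])"
    using snoc_in_double[OF xs emb_in_double] in_double[OF f]
    by (intro double.additive_append)
  moreover have "br' (map emb xs @ [emb (fst u)]) = emb (br (xs @ [fst u]))"
    using bracket_emb[of "xs @ [fst u]"] xs n by simp
  ultimately have "snd (br' (map emb xs @ [u])) = snd (br' (map emb xs @ [(0, snd u)]))"
    by (simp add: prod_eq_iff)
  then show ?thesis using p[OF f] by simp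
qed

abbreviation (input) pr where "pr \<equiv> product_of_form"

lemma product_eqI:
  assumes "\<And>u. u \<in> double_carrier scale \<Longrightarrow> snd u x = snd u y"
  shows "x = y"
  by (rule dual_separates) (use assms[of "(0, f)" for f] in \<open>simp add: mem_double_carrier_iff\<close>)

lemma pairing_simps:
  assumes "u \<in> double_carrier scale"
  shows "snd u (x + y) = snd u x + snd u y" "snd u (scale c x) = c * snd u x" "snd u (- x) = - snd u x"
    "snd u (\<Sum>i\<in>I. g i) = (\<Sum>i\<in>I. snd u (g i))"
  using assms by (simp_all add: mem_double_carrier_iff dual_add dual_scale dual_minus dual_sum)

text \<open>This is \<open>form_bracket\<close> of the double with all \<open>x_i\<close> vectors:
  the pairings on its right-hand side are, up to sign, values of u on products.\<close>

lemma commutator_product_of_form: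
  assumes xs: "length xs = n"
  shows "commutator n scale pr xs = br xs"
proof (rule product_eqI)
  fix u assume u: "u \<in> double_carrier scale"
  have len: "length (omit_nth i xs) = n - 1" if "i < n" for i
    using that xs by (simp add: omit_nth_def)
  have e: "map emb xs \<in> nlists n (double_carrier scale)"
    using xs emb_in_double by (auto simp: nlists_def)
  have "- snd u (br xs) = - (\<Sum>i<n. (-1) ^ (n - Suc i) *
      double_form (map emb xs ! i) (br' (omit_nth i (map emb xs) @ [u])))"
    using double.form_bracket[OF e u] by (simp add: bracket_emb[OF xs] double_form_eq)
  also have "\<dots> = (\<Sum>i<n. (-1) ^ (n - Suc i) * snd (br' (map emb (omit_nth i xs) @ [u])) (xs ! i))"
    unfolding sum_negf[symmetric]
    by (rule sum.cong) (simp_all add: xs double_form_eq map_omit_nth)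
  finally have "snd u (br xs) = - (\<Sum>i<n. (-1) ^ (n - Suc i) * snd (br' (map emb (omit_nth i xs) @ [u])) (xs ! i))"
    by (metis minus_minus)
  moreover have "snd u (commutator n scale pr xs) =
      - (\<Sum>i<n. (-1) ^ (n - Suc i) * snd (br' (map emb (omit_nth i xs) @ [u])) (xs ! i))"
    unfolding commutator_def sum_negf[symmetric] pairing_simps[OF u]
    by (rule sum.cong) (simp_all add: product_of_form len u)
  ultimately show "snd u (commutator n scale pr xs) = snd u (br xs)" by simp
qed

lemma update_cases:
  assumes "length xs = n" "i < n"
  obtains (last) ys v where "xs = ys @ [v]" "length ys = n - 1" "\<And>u. xs[i := u] = ys @ [u]" "i = n - 1"
  | (init) ys v where "xs = ys @ [v]" "length ys = n - 1" "i < n - 1" "\<And>u. xs[i := u] = ys[i := u] @ [v]"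
proof -
  have xs: "xs = butlast xs @ [last xs]" "length (butlast xs) = n - 1"
    using assms n by (auto intro!: append_butlast_last_id[symmetric])
  show thesis
  proof (cases "i = n - 1")
    case True
    then have "xs[i := u] = butlast xs @ [u]" for u
      by (subst xs(1)) (simp only: list_update_append xs(2), simp)
    then show thesis using last xs True by blast
  next
    case False
    then have i: "i < n - 1" using assms by simp
    then have "xs[i := u] = (butlast xs)[i := u] @ [last xs]" for u
      by (subst xs(1)) (simp only: list_update_append1 xs(2))
    then show thesis using init xs i by blast
  qed
qed

text \<open>Linearity in the last argument is that of a functional; in the other arguments it is
  inherited from the bracket of the double.\<close>

lemma product_multilinear: "multilinear_operation n scale V pr"
proof unfold_locales
  fix xs i u w assume "xs \<in> nlists n V" and i: "i < n"
  then have "length xs = n" by (simp add: nlists_def)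
  then show "pr (xs[i := u + w]) = pr (xs[i := u]) + pr (xs[i := w])" using i
  proof (cases rule: update_cases)
    case (last ys v)
    show ?thesis
      by (rule product_eqI)
        (use last(2) in \<open>simp add: last(3) pairing_simps product_of_form dual_add[OF bracket_snoc_in_dual]\<close>)
  next
    case (init ys v)
    show ?thesis
    proof (rule product_eqI)
      fix t assume t: "t \<in> double_carrier scale"
      have "br' ((map emb ys @ [t])[i := emb u + emb w]) =
          br' ((map emb ys @ [t])[i := emb u]) + br' ((map emb ys @ [t])[i := emb w])"
        using snoc_in_double[OF init(2) t] i emb_in_double by (intro double.additive)
      then show "snd t (pr (xs[i := u + w])) = snd t (pr (xs[i := u]) + pr (xs[i := w]))"
        using init(2,3) t unfolding init(4)
        by (simp add: pairing_simps product_of_form map_update list_update_append)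
    qed
  qed
next
  fix xs i u c assume "xs \<in> nlists n V" and i: "i < n"
  then have "length xs = n" by (simp add: nlists_def)
  then show "pr (xs[i := scale c u]) = scale c (pr (xs[i := u]))" using i
  proof (cases rule: update_cases)
    case (last ys v)
    show ?thesis
      by (rule product_eqI)
        (use last(2) in \<open>simp add: last(3) pairing_simps product_of_form dual_scale[OF bracket_snoc_in_dual]\<close>)
  next
    case (init ys v)
    show ?thesis
    proof (rule product_eqI)
      fix t assume t: "t \<in> double_carrier scale"
      have "br' ((map emb ys @ [t])[i := double_scale scale c (emb u)]) =
          double_scale scale c (br' ((map emb ys @ [t])[i := emb u]))"
        using snoc_in_double[OF init(2) t] i emb_in_double by (intro double.homogeneous)
      moreover have "double_scale scale c (emb u) = emb (scale c u)"
        by (simp add: double_scale_def zero_fun_def)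
      ultimately show "snd t (pr (xs[i := scale c u])) = snd t (scale c (pr (xs[i := u])))"
        using init(2,3) t unfolding init(4)
        by (simp add: pairing_simps product_of_form map_update list_update_append)
    qed
  qed
qed (simp add: UNIV)

text \<open>Pair each identity with the functional part of an arbitrary t and move all products onto
  t. The derivation identity becomes \<open>action_commutator\<close> of the adjoint action of the
  double.\<close>

lemma product_pre_Lie: "n_pre_Lie_algebra n scale V pr"
proof -
  interpret product: multilinear_operation n scale V pr by (rule product_multilinear)
  show ?thesis
  proof unfold_locales
    fix xs i j assume xs: "xs \<in> nlists n V" and ij: "i < n - 1" "j < n - 1" "i \<noteq> j"
    obtain ys v where ys: "xs = ys @ [v]" "length ys = n - 1"
      using xs n by (metis nlistsE_length append_butlast_last_id length_butlast list.size(3) not_numeral_le_zero)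
    show "pr (xs[i := xs ! j, j := xs ! i]) = - pr xs"
    proof (rule product_eqI)
      fix t assume t: "t \<in> double_carrier scale"
      have "br' ((map emb ys @ [t])[i := (map emb ys @ [t]) ! j, j := (map emb ys @ [t]) ! i]) =
          - br' (map emb ys @ [t])"
        using snoc_in_double[OF ys(2) t] ij by (intro double.skew) auto
      then show "snd t (pr (xs[i := xs ! j, j := xs ! i])) = snd t (- pr xs)"
        using ys t ij by (simp add: pairing_simps product_of_form map_update list_update_append nth_append)
    qed
  next
    fix xs zs assume xs: "xs \<in> nlists (n - 1) V" and zs: "zs \<in> nlists n V"
    obtain ys v where ys: "zs = ys @ [v]" "length ys = n - 1"
      using zs n by (metis nlistsE_length append_butlast_last_id length_butlast list.size(3) not_numeral_le_zero)
    have lx: "length xs = n - 1" using xs by (simp add: nlists_def)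
    have com: "commutator n scale pr (xs @ [ys ! i]) = br (xs @ [ys ! i])" for i
      using lx n by (intro commutator_product_of_form) simp
    have last: "zs[n - 1 := w] = ys @ [w]" "zs ! (n - 1) = v" for w
      using ys by (simp_all add: list_update_append nth_append)
    have init: "zs[i := w] = ys[i := w] @ [v]" "zs ! i = ys ! i" if "i < n - 1" for i w
      using that ys by (simp_all add: list_update_append nth_append)
    show "pr (xs @ [pr zs]) = (\<Sum>i<n - 1. pr (zs[i := commutator n scale pr (xs @ [zs ! i])])) +
        pr (zs[n - 1 := pr (xs @ [zs ! (n - 1)])])"
    proof (rule product_eqI)
      fix t assume t: "t \<in> double_carrier scale"
      note closed' = double.closed[OF snoc_in_double]
      have e: "map emb xs \<in> nlists (n - 1) (double_carrier scale)"
          "map emb ys \<in> nlists (n - 1) (double_carrier scale)"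
        using lx ys emb_in_double by (auto simp: nlists_def)
      have "snd (br' (map emb xs @ [br' (map emb ys @ [t])])) v =
          (\<Sum>i<n - 1. snd (br' ((map emb ys)[i := br' (map emb xs @ [map emb ys ! i])] @ [t])) v) +
          snd (br' (map emb ys @ [br' (map emb xs @ [t])])) v"
        unfolding double.action_commutator[OF e t] by (simp add: snd_sum sum_fun_apply)
      moreover have "snd (br' ((map emb ys)[i := br' (map emb xs @ [map emb ys ! i])] @ [t])) v =
          - snd t (pr (zs[i := commutator n scale pr (xs @ [zs ! i])]))" if i: "i < n - 1" for i
      proof -
        have "br' (map emb xs @ [map emb ys ! i]) = emb (br (xs @ [ys ! i]))"
          using bracket_emb[of "xs @ [ys ! i]"] lx n ys i by simp
        then show ?thesis
          using i ys(2) t unfolding init[OF i] com by (simp add: product_of_form map_update)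
      qed
      ultimately show "snd t (pr (xs @ [pr zs])) =
          snd t ((\<Sum>i<n - 1. pr (zs[i := commutator n scale pr (xs @ [zs ! i])])) +
            pr (zs[n - 1 := pr (xs @ [zs ! (n - 1)])]))"
        using t lx ys closed' unfolding last unfolding ys(1)
        by (simp add: pairing_simps product_of_form sum_negf)
    qed
  next
    fix xs zs assume xs: "xs \<in> nlists n V" and zs: "zs \<in> nlists (n - 1) V"
    have lx: "length xs = n" using xs by (simp add: nlists_def)
    have "length zs = Suc (n - 2)" using zs n by (simp add: nlists_def)
    then obtain ys v where ys: "zs = ys @ [v]" "length ys = n - 2"
      by (metis append_butlast_last_id length_butlast list.size(3) nat.distinct(1) diff_Suc_1)
    have len: "length (omit_nth i xs) = n - 1" if "i < n" for i
      using that lx by (simp add: omit_nth_def)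
    have len': "length (x # ys) = n - 1" for x using ys n by simp
    show "pr (commutator n scale pr xs # zs) =
        (\<Sum>i<n. scale ((-1) ^ (n - Suc i)) (pr (omit_nth i xs @ [pr (xs ! i # zs)])))"
    proof (rule product_eqI)
      fix t assume t: "t \<in> double_carrier scale"
      have e: "map emb xs \<in> nlists n (double_carrier scale)"
          "map emb ys \<in> nlists (n - 2) (double_carrier scale)"
        using lx ys emb_in_double by (auto simp: nlists_def)
      have "snd t (pr ((br xs # ys) @ [v])) = - snd (br' (br' (map emb xs) # map emb ys @ [t])) v"
        unfolding product_of_form[OF len' t] using bracket_emb[OF lx] by simp
      also have "\<dots> = (\<Sum>i<n. (-1) ^ (n - Suc i) *
          snd (br' (map emb (xs ! i # ys) @ [br' (map emb (omit_nth i xs) @ [t])])) v)"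
        \<comment> \<open>Moving products onto t reverses composites, so \<open>x_i\<close> acts
          last on t; this calls for the dual form of \<open>action_bracket\<close>.\<close>
        unfolding double.dual_action_bracket[OF e t]
        by (simp add: snd_sum sum_fun_apply lx map_omit_nth)
      also have "\<dots> = (\<Sum>i<n. (-1) ^ (n - Suc i) * snd t (pr (omit_nth i xs @ [pr ((xs ! i # ys) @ [v])])))"
      proof (rule sum.cong[OF refl])
        fix i assume "i \<in> {..<n}"
        then have i: "i < n" by simp
        show "(-1) ^ (n - Suc i) *
            snd (br' (map emb (xs ! i # ys) @ [br' (map emb (omit_nth i xs) @ [t])])) v =
          (-1) ^ (n - Suc i) * snd t (pr (omit_nth i xs @ [pr ((xs ! i # ys) @ [v])]))"
          unfolding product_of_form[OF len[OF i] t]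
            product_of_form[OF len' double.closed[OF snoc_in_double[OF len[OF i] t]]] by simp
      qed
      finally show "snd t (pr (commutator n scale pr xs # zs)) =
        snd t (\<Sum>i<n. scale ((-1) ^ (n - Suc i)) (pr (omit_nth i xs @ [pr (xs ! i # zs)])))"
        by (simp add: commutator_product_of_form[OF lx] pairing_simps[OF t] ys(1))
    qed
  qed
qed

lemma sub_adjacent_of_phase_space: "\<exists>pr. sub_adjacent n scale V pr br"
  using product_pre_Lie commutator_product_of_form
  unfolding sub_adjacent_def by (auto simp: nlists_def)

end

end

section \<open>From n-pre-Lie algebras to phase spaces\<close>

text \<open>The increasing enumeration of the indices other than \<open>i\<close>.\<close>

definition skip :: "nat \<Rightarrow> nat \<Rightarrow> nat" where
  "skip i l = (if l < i then l else Suc l)"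

text \<open>The position to which entry j moves when entry i is omitted; meaningful for j different
  from i, where it inverts \<open>skip i\<close>.\<close>

definition unskip :: "nat \<Rightarrow> nat \<Rightarrow> nat" where
  "unskip i j = (if j < i then j else j - 1)"

lemma length_omit_nth: "i < length xs \<Longrightarrow> length (omit_nth i xs) = length xs - 1"
  by (simp add: omit_nth_def)

lemma nth_omit_nth: "i < length xs \<Longrightarrow> l < length xs - 1 \<Longrightarrow> omit_nth i xs ! l = xs ! skip i l"
  by (auto simp: omit_nth_def skip_def nth_append)

lemma omit_nth_snoc_less: "i < length xs \<Longrightarrow> omit_nth i (xs @ [x]) = omit_nth i xs @ [x]"
  by (simp add: omit_nth_def)

lemma omit_nth_snoc_eq: "length xs = i \<Longrightarrow> omit_nth i (xs @ [x]) = xs"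
  by (simp add: omit_nth_def)

lemma skip_less: "i < Suc m \<Longrightarrow> l < m \<Longrightarrow> skip i l < Suc m"
  by (simp add: skip_def)

text \<open>Both sides omit the original positions i and \<open>skip i l\<close>, in opposite
  orders.\<close>

lemma omit_nth_omit_nth:
  assumes "i < length xs" "l < length xs - 1"
  shows "omit_nth (unskip (skip i l) i) (omit_nth (skip i l) xs) = omit_nth l (omit_nth i xs)"
proof (rule nth_equalityI)
  have "skip i l < length xs" "unskip (skip i l) i < length xs - 1"
    using assms by (auto simp: skip_def unskip_def)
  note b = assms this
  show "length (omit_nth (unskip (skip i l) i) (omit_nth (skip i l) xs)) = length (omit_nth l (omit_nth i xs))"
    using b by (simp add: length_omit_nth)
  fix k assume "k < length (omit_nth (unskip (skip i l) i) (omit_nth (skip i l) xs))"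
  then have k: "k < length xs - 1 - 1" using b by (simp add: length_omit_nth)
  have k': "skip (unskip (skip i l) i) k < length xs - 1" "skip l k < length xs - 1"
    using k by (auto simp: skip_def)
  have "skip (skip i l) (skip (unskip (skip i l) i) k) = skip i (skip l k)"
    by (auto simp: skip_def unskip_def)
  then show "omit_nth (unskip (skip i l) i) (omit_nth (skip i l) xs) ! k = omit_nth l (omit_nth i xs) ! k"
    using b k k' by (simp add: nth_omit_nth length_omit_nth)
qed

lemma omit_nth_update_same: "omit_nth i (xs[i := x]) = omit_nth i xs"
  by (simp add: omit_nth_def)

lemma omit_nth_update_other:
  assumes "i < length xs" "j < length xs" "i \<noteq> j"
  shows "omit_nth i (xs[j := x]) = (omit_nth i xs)[unskip i j := x]"
  using assms
  by (auto simp: omit_nth_def unskip_def list_update_append list_update_beyond take_update_swap drop_update_swap)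

lemma nth_omit_nth_unskip:
  assumes "i < length xs" "j < length xs" "i \<noteq> j"
  shows "omit_nth i xs ! unskip i j = xs ! j"
  using assms by (auto simp: nth_omit_nth skip_def unskip_def)

lemma sum_skip:
  assumes "i < Suc m"
  shows "(\<Sum>j\<in>{..<Suc m} - {i}. h j) = (\<Sum>l<m. h (skip i l))"
  using assms
  by (intro sum.reindex_bij_witness[where i = "skip i" and j = "unskip i"])
    (auto simp: skip_def unskip_def)

lemma skip_unskip: "skip (skip i l) (unskip (skip i l) i) = i"
  and unskip_skip: "unskip i (skip i l) = l"
  and unskip_less: "i < Suc m \<Longrightarrow> l < m \<Longrightarrow> unskip (skip i l) i < m"
  by (auto simp: skip_def unskip_def)

lemma minus_one_power_opposite:
  "odd a = even b \<Longrightarrow> (-1 :: 'k::ring_1) ^ b = - ((-1) ^ a)"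
  by (cases "even a") auto

text \<open>A pair (i, l) encodes two distinct positions with an order of omission. Reversing this
  order is an involution that changes i + l by exactly one, hence flips the sign, and it carries H
  to K.\<close>

lemma sum_skip_pairing:
  fixes H K :: "nat \<Rightarrow> nat \<Rightarrow> 'k::comm_ring_1"
  assumes "\<And>i l. i < Suc m \<Longrightarrow> l < m \<Longrightarrow> K (skip i l) (unskip (skip i l) i) = H i l"
  shows "(\<Sum>i<Suc m. \<Sum>l<m. (-1) ^ (m - i) * ((-1) ^ (m - l) * (H i l + K i l))) = 0"
proof -
  define e :: "nat \<Rightarrow> nat \<Rightarrow> 'k" where "e i l = (-1) ^ (m - i) * (-1) ^ (m - l)" for i l
  have sign: "e (skip i l) (unskip (skip i l) i) = - e i l" if "i < Suc m" "l < m" for i l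
  proof -
    have "odd (m - i + (m - l)) = even (m - skip i l + (m - unskip (skip i l) i))"
    proof (cases "l < i")
      case True
      then have "m - skip i l + (m - unskip (skip i l) i) = Suc (m - i + (m - l))"
        using that by (simp add: skip_def unskip_def)
      then show ?thesis by (simp only: even_Suc)
    next
      case False
      then have "m - i + (m - l) = Suc (m - skip i l + (m - unskip (skip i l) i))"
        using that by (simp add: skip_def unskip_def)
      then show ?thesis by (simp only: even_Suc not_not)
    qed
    then show ?thesis unfolding e_def power_add[symmetric] by (rule minus_one_power_opposite)
  qed
  let ?I = "{..<Suc m} \<times> {..<m}"
  have "(\<Sum>(i, l)\<in>?I. - (e i l * H i l)) = (\<Sum>(i, l)\<in>?I. e i l * K i l)"
    by (rule sum.reindex_bij_witness[where i = "\<lambda>(i, l). (skip i l, unskip (skip i l) i)"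
          and j = "\<lambda>(i, l). (skip i l, unskip (skip i l) i)"])
      (auto simp: assms sign skip_unskip unskip_skip skip_less unskip_less)
  then have "(\<Sum>(i, l)\<in>?I. e i l * H i l + e i l * K i l) = 0"
    unfolding case_prod_beta sum_negf sum.distrib neg_eq_iff_add_eq_0 .
  then show ?thesis
    unfolding sum.cartesian_product[symmetric] e_def distrib_left[symmetric] mult.assoc .
qed

lemma sum_swap_distinct:
  assumes "finite I"
  shows "(\<Sum>j\<in>I. \<Sum>i\<in>I - {j}. h i j) = (\<Sum>i\<in>I. \<Sum>j\<in>I - {i}. h i j)"
  using assms
  by (simp add: sum.Sigma)
    (rule sum.reindex_bij_witness[where i = prod.swap and j = prod.swap]; auto)

section \<open>The semidirect bracket\<close>

context n_Lie_algebra
begin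

context
  fixes pr
  assumes sub: "sub_adjacent n scale V pr br" and UNIV: "V = UNIV" and n: "n \<ge> 2"
begin

interpretation fin_dim_UNIV scale
  using fin_dim_space_axioms UNIV by (simp add: fin_dim_UNIV_def)

interpretation product: n_pre_Lie_algebra n scale V pr
  using sub by (simp add: sub_adjacent_def)

lemma nlists_iff: "xs \<in> nlists k V \<longleftrightarrow> length xs = k"
  by (simp add: UNIV in_nlists_UNIV)

lemma commutator_eq: "length xs = n \<Longrightarrow> commutator n scale pr xs = br xs"
  using sub by (simp add: sub_adjacent_def nlists_iff)

interpretation product: n_Lie_action n scale V pr br
proof unfold_locales
  show "alternating (n - 1) V (\<lambda>xs. pr (xs @ [v]))" if "v \<in> V" for v
    using n that by (intro alternating_snoc product.skew) auto
next
  fix xs ys v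
  assume xs: "xs \<in> nlists (n - 1) V" and ys: "ys \<in> nlists (n - 1) V" and v: "v \<in> V"
  have len: "length ys = n - 1" "length xs = n - 1" using xs ys by (simp_all add: nlists_iff)
  have "pr ((ys @ [v])[i := commutator n scale pr (xs @ [(ys @ [v]) ! i])]) =
      pr (ys[i := br (xs @ [ys ! i])] @ [v])" if "i < n - 1" for i
    using that n len by (simp add: commutator_eq list_update_append nth_append)
  moreover have "(ys @ [v])[n - 1 := pr (xs @ [(ys @ [v]) ! (n - 1)])] = ys @ [pr (xs @ [v])]"
    using len by (simp add: list_update_append nth_append)
  ultimately show "pr (xs @ [pr (ys @ [v])]) =
      (\<Sum>i<n - 1. pr (ys[i := br (xs @ [ys ! i])] @ [v])) + pr (ys @ [pr (xs @ [v])])"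
    using product.derivation_identity[OF xs, of "ys @ [v]"] len n by (simp add: nlists_iff)
next
  fix xs ys v
  assume "xs \<in> nlists n V" "ys \<in> nlists (n - 2) V" "v \<in> V"
  then show "pr (br xs # ys @ [v]) =
      (\<Sum>i<n. scale ((-1) ^ (n - Suc i)) (pr (omit_nth i xs @ [pr (xs ! i # ys @ [v])])))"
    using product.commutator_identity[of xs "ys @ [v]"] n by (simp add: nlists_iff commutator_eq)
qed (use n closed bracket_is_alternating in auto)

text \<open>Entry i supplies the functional and all others act through their vector parts. The minus
  sign of \<open>L^*\<close> is left to \<open>phase_bracket\<close>.\<close>

definition coadjoint_term :: "('a \<times> ('a \<Rightarrow> 'k)) list \<Rightarrow> nat \<Rightarrow> 'a \<Rightarrow> 'k" where
  "coadjoint_term us i y = snd (us ! i) (pr (omit_nth i (map fst us) @ [y]))"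

text \<open>The semidirect product with the coadjoint representation \<open>L\<^sup>*\<close>, where
  \<open>\<langle>L\<^sup>*(x\<^sub>1, \<dots>, x\<^bsub>n-1\<^esub>) f, y\<rangle> = - \<langle>f, {x\<^sub>1, \<dots>, x\<^bsub>n-1\<^esub>, y}\<rangle>\<close>.\<close>

definition phase_bracket :: "('a \<times> ('a \<Rightarrow> 'k)) list \<Rightarrow> 'a \<times> ('a \<Rightarrow> 'k)" where
  "phase_bracket us =
    (br (map fst us), \<lambda>y. - (\<Sum>i<n. (-1) ^ (n - Suc i) * coadjoint_term us i y))"

lemma fst_phase_bracket: "fst (phase_bracket us) = br (map fst us)"
  and snd_phase_bracket:
    "snd (phase_bracket us) y = - (\<Sum>i<n. (-1) ^ (n - Suc i) * coadjoint_term us i y)"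
  by (simp_all add: phase_bracket_def)

lemma in_double_nth: "us \<in> nlists k (double_carrier scale) \<Longrightarrow> i < k \<Longrightarrow> snd (us ! i) \<in> dual_carrier scale"
  using nlistsE_nth_in[of us k "double_carrier scale" i] by (simp add: mem_double_carrier_iff)

lemma pr_update:
  assumes "length zs = n - 1" "i < n - 1"
  shows "pr (zs[i := u + w] @ [y]) = pr (zs[i := u] @ [y]) + pr (zs[i := w] @ [y])"
    "pr (zs[i := scale c u] @ [y]) = scale c (pr (zs[i := u] @ [y]))"
  using product.additive[of "zs @ [y]" i u w] product.homogeneous[of "zs @ [y]" i u c] assms n
  by (simp_all add: nlists_iff in_nlists_UNIV UNIV list_update_append)

lemma pr_snoc:
  assumes "length zs = n - 1"
  shows "pr (zs @ [u + w]) = pr (zs @ [u]) + pr (zs @ [w])"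
    "pr (zs @ [scale c u]) = scale c (pr (zs @ [u]))"
  using product.additive_append[of zs u "[]" w] product.homogeneous_append[of zs u "[]" c] assms n
  by (simp_all add: nlists_iff in_nlists_UNIV UNIV)

lemma coadjoint_term_linear:
  assumes "us \<in> nlists n (double_carrier scale)" "i < n"
  shows "coadjoint_term us i (y + z) = coadjoint_term us i y + coadjoint_term us i z"
    "coadjoint_term us i (scale c y) = c * coadjoint_term us i y"
  using assms in_double_nth[OF assms]
  by (simp_all add: coadjoint_term_def pr_snoc length_omit_nth nlistsE_length dual_add dual_scale)

lemma coadjoint_term_update:
  assumes us: "us \<in> nlists n (double_carrier scale)" and ij: "i < n" "j < n"
  shows "coadjoint_term (us[j := p + q]) i y = coadjoint_term (us[j := p]) i y + coadjoint_term (us[j := q]) i y"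
    "coadjoint_term (us[j := double_scale scale c p]) i y = c * coadjoint_term (us[j := p]) i y"
proof -
  have len: "length us = n" using us by (rule nlistsE_length)
  have d: "snd (us ! i) \<in> dual_carrier scale" using in_double_nth[OF us ij(1)] .
  have "unskip i j < n - 1" if "i \<noteq> j" using ij that by (auto simp: unskip_def)
  then show "coadjoint_term (us[j := p + q]) i y = coadjoint_term (us[j := p]) i y + coadjoint_term (us[j := q]) i y"
    "coadjoint_term (us[j := double_scale scale c p]) i y = c * coadjoint_term (us[j := p]) i y"
    using ij len d
    by (cases "i = j"; simp add: coadjoint_term_def map_update omit_nth_update_same omit_nth_update_other
        pr_update length_omit_nth dual_add dual_scale)+
qed

text \<open>The functional travels with its entry, so terms at exchanged positions are compared.
  Among the remaining vectors, the other exchanged one has moved past b.\<close>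

lemma coadjoint_term_swap:
  assumes us: "us = a @ p # b @ q # c" "us \<in> nlists n (double_carrier scale)"
  shows "coadjoint_term (a @ q # b @ p # c) (Suc (length a + length b)) y =
      (-1) ^ length b * coadjoint_term us (length a) y"
    "coadjoint_term (a @ q # b @ p # c) (length a) y =
      (-1) ^ length b * coadjoint_term us (Suc (length a + length b)) y"
proof -
  have d: "snd p \<in> dual_carrier scale" "snd q \<in> dual_carrier scale"
    using us by (auto simp: nlists_def mem_double_carrier_iff)
  have len: "n = length us" using nlistsE_length[OF us(2)] ..
  have nth: "(a @ u # b @ w # c) ! Suc (length a + length b) = w" for u w
    using nth_append_length_plus[of a "u # b @ w # c" "Suc (length b)"] by simp
  let ?f = "map fst"
  have omit: "omit_nth (length a) (?f (a @ u # b @ w # c)) = ?f a @ ?f b @ fst w # ?f c"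
    "omit_nth (Suc (length a + length b)) (?f (a @ u # b @ w # c)) = ?f a @ fst u # ?f b @ ?f c" for u w
    by (simp_all add: omit_nth_def)
  have move: "pr (?f a @ fst u # ?f b @ ?f c @ [y]) =
      scale ((-1) ^ length b) (pr (?f a @ ?f b @ fst u # ?f c @ [y]))" for u
    using alternating_move[OF product.action_alternating[of y], of "?f a" "fst u" "?f b" "?f c"] us len
    by (simp add: nlists_iff in_nlists_UNIV UNIV)
  show "coadjoint_term (a @ q # b @ p # c) (Suc (length a + length b)) y =
      (-1) ^ length b * coadjoint_term us (length a) y"
    unfolding coadjoint_term_def us(1) nth omit using d by (simp add: move dual_scale)
  show "coadjoint_term (a @ q # b @ p # c) (length a) y =
      (-1) ^ length b * coadjoint_term us (Suc (length a + length b)) y"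
    unfolding coadjoint_term_def us(1) nth omit
    using d by (simp add: move dual_scale mult.assoc[symmetric] flip: power_mult_distrib)
qed

text \<open>The signs attached to positions i and j differ by (-1)^(j - i), and
  \<open>coadjoint_term_swap\<close> contributes (-1)^(j - i - 1); together they give -1.\<close>

lemma phase_bracket_skew_less:
  assumes us: "us \<in> nlists n (double_carrier scale)" and ij: "i < j" "j < n"
  shows "phase_bracket (us[i := us ! j, j := us ! i]) = - phase_bracket us"
proof (rule prod_eqI)
  have len: "length us = n" using us by (rule nlistsE_length)
  have ne: "i < n" "i \<noteq> j" using ij by auto
  let ?us = "us[i := us ! j, j := us ! i]" and ?xs = "map fst us"
  have xs: "map fst ?us = ?xs[i := ?xs ! j, j := ?xs ! i]"
    using ij ne len by (simp add: map_update)
  show "fst (phase_bracket ?us) = fst (- phase_bracket us)"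
    unfolding fst_uminus fst_phase_bracket xs using len ij ne by (intro skew) (simp_all add: nlists_iff)
  define a b c where "a = take i us" and "b = take (j - Suc i) (drop (Suc i) us)" and "c = drop (Suc j) us"
  have la: "length a = i" and lb: "Suc (i + length b) = j"
    using ij ne len by (simp_all add: a_def b_def)
  have "drop (Suc i) us = b @ drop (j - Suc i) (drop (Suc i) us)"
    unfolding b_def by (rule append_take_drop_id[symmetric])
  also have "drop (j - Suc i) (drop (Suc i) us) = us ! j # c"
    using ij len by (simp add: c_def Cons_nth_drop_Suc)
  finally have dec: "us = a @ us ! i # b @ us ! j # c"
    using id_take_nth_drop[of i us] ne len by (simp add: a_def)
  have dec': "?us = a @ us ! j # b @ us ! i # c"
  proof -
    have "(a @ p # b @ q # c)[i := q, j := p] = a @ q # b @ p # c" for p q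
      using la lb by (auto simp: list_update_append)
    from this[of "us ! i" "us ! j"] show ?thesis unfolding dec[symmetric] .
  qed
  note swap = coadjoint_term_swap[OF dec us]
  show "snd (phase_bracket ?us) = snd (- phase_bracket us)"
  proof
    fix y
    let ?t = "\<lambda>k. if k = i then j else if k = j then i else k"
    have "(\<Sum>k<n. (-1) ^ (n - Suc k) * coadjoint_term ?us k y) =
        (\<Sum>k<n. - ((-1) ^ (n - Suc k) * coadjoint_term us k y))"
    proof (rule sum.reindex_bij_witness[where i = ?t and j = ?t])
      fix k assume "k \<in> {..<n}"
      then have k: "k < n" by simp
      consider "k = i" | "k = j" | "k \<noteq> i" "k \<noteq> j" by blast
      then show "- ((-1) ^ (n - Suc (?t k)) * coadjoint_term us (?t k) y) =
          (-1) ^ (n - Suc k) * coadjoint_term ?us k y"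
      proof cases
        case 1
        have "n - Suc i + length b = Suc (n - Suc j + 2 * length b)"
          using lb la ij by simp
        then have "(-1 :: 'k) ^ (n - Suc i) * (-1) ^ length b = - ((-1) ^ (n - Suc j))"
          unfolding power_add[symmetric] by (simp add: power_add power_mult)
        then show ?thesis
          using 1 swap(2) ne unfolding dec' la lb by (simp add: mult.assoc[symmetric])
      next
        case 2
        have "n - Suc i = Suc (n - Suc j + length b)"
          using lb la ij by simp
        then have "(-1 :: 'k) ^ (n - Suc j) * (-1) ^ length b = - ((-1) ^ (n - Suc i))"
          unfolding power_add[symmetric] by simp
        then show ?thesis
          using 2 swap(1) ne unfolding dec' la lb by (simp add: mult.assoc[symmetric])
      next
        case 3
        \<comment> \<open>Here the functional stays in place and both exchanged entries are among
          the acting vectors, so skewness of \<open>pr\<close> applies.\<close>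
        let ?zs = "omit_nth k ?xs"
        have u: "unskip k i < n - 1" "unskip k j < n - 1" "unskip k i \<noteq> unskip k j"
          using 3 ij k by (auto simp: unskip_def)
        have lz: "length ?zs = n - 1" using k len by (simp add: length_omit_nth)
        have "omit_nth k (map fst ?us) =
            ?zs[unskip k i := ?zs ! unskip k j, unskip k j := ?zs ! unskip k i]"
          unfolding xs using 3 ij ne k len
          by (simp add: omit_nth_update_other nth_omit_nth_unskip)
        moreover have "pr (?zs[unskip k i := ?zs ! unskip k j, unskip k j := ?zs ! unskip k i] @ [y]) =
            - pr (?zs @ [y])"
          using product.action_alternating[of y] u lz unfolding alternating_def
          by (simp add: nlists_iff in_nlists_UNIV UNIV)
        ultimately show ?thesis
          using 3 in_double_nth[OF us k] by (simp add: coadjoint_term_def dual_minus)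
      qed
    qed (use ij ne in auto)
    then show "snd (phase_bracket ?us) y = snd (- phase_bracket us) y"
      by (simp add: snd_phase_bracket sum_negf)
  qed
qed

lemma phase_bracket_skew:
  assumes "us \<in> nlists n (double_carrier scale)" "i < n" "j < n" "i \<noteq> j"
  shows "phase_bracket (us[i := us ! j, j := us ! i]) = - phase_bracket us"
proof (cases "i < j")
  case True
  then show ?thesis using assms by (intro phase_bracket_skew_less)
next
  case False
  then have "j < i" using assms by simp
  from phase_bracket_skew_less[OF assms(1) this assms(2)] show ?thesis
    by (subst list_update_swap) (use assms in auto)
qed

lemma multilinear_phase_bracket:
  "multilinear_operation n (double_scale scale) (double_carrier scale) phase_bracket"
proof -
  interpret double: fin_dim_space "double_scale scale" "double_carrier scale" by (rule fin_dim_double)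
  show ?thesis
  proof unfold_locales
    fix us assume "us \<in> nlists n (double_carrier scale)"
    then show "phase_bracket us \<in> double_carrier scale"
      unfolding mem_double_carrier_iff mem_dual_carrier_iff
      by (simp add: snd_phase_bracket coadjoint_term_linear distrib_left sum.distrib sum_distrib_left
          mult.left_commute)
  next
    fix us i and u v :: "'a \<times> ('a \<Rightarrow> 'k)"
    assume us: "us \<in> nlists n (double_carrier scale)" and i: "i < n"
    have "map fst us \<in> nlists n V" using us by (simp add: nlists_iff nlistsE_length)
    then have "br ((map fst us)[i := fst u + fst v]) = br ((map fst us)[i := fst u]) + br ((map fst us)[i := fst v])"
      using i by (intro additive) (simp_all add: UNIV)
    then show "phase_bracket (us[i := u + v]) = phase_bracket (us[i := u]) + phase_bracket (us[i := v])"
      by (intro prod_eqI ext)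
        (simp_all add: fst_phase_bracket snd_phase_bracket map_update coadjoint_term_update[OF us _ i]
          distrib_left sum.distrib)
  next
    fix us i c and u :: "'a \<times> ('a \<Rightarrow> 'k)"
    assume us: "us \<in> nlists n (double_carrier scale)" and i: "i < n"
    have "map fst us \<in> nlists n V" using us by (simp add: nlists_iff nlistsE_length)
    then have "br ((map fst us)[i := scale c (fst u)]) = scale c (br ((map fst us)[i := fst u]))"
      using i by (intro homogeneous) (simp_all add: UNIV)
    then show "phase_bracket (us[i := double_scale scale c u]) = double_scale scale c (phase_bracket (us[i := u]))"
      by (intro prod_eqI ext)
        (simp_all add: fst_phase_bracket snd_phase_bracket map_update coadjoint_term_update[OF us _ i]
          sum_distrib_left mult.left_commute)
  qed
qed

lemma snd_phase_bracket_snoc: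
  assumes "length us = n - 1"
  shows "snd (phase_bracket (us @ [w])) y =
    - ((\<Sum>l<n - 1. (-1) ^ (n - Suc l) * snd (us ! l) (pr (omit_nth l (map fst us) @ [fst w, y])))
      + snd w (pr (map fst us @ [y])))"
proof -
  have m: "n = Suc (n - 1)" using n by simp
  have "(\<Sum>i<n. (-1) ^ (n - Suc i) * coadjoint_term (us @ [w]) i y) =
      (\<Sum>i<n - 1. (-1) ^ (n - Suc i) * coadjoint_term (us @ [w]) i y) + coadjoint_term (us @ [w]) (n - 1) y"
    by (subst (1) m, subst sum.lessThan_Suc) simp
  moreover have "coadjoint_term (us @ [w]) (n - 1) y = snd w (pr (map fst us @ [y]))"
    using assms by (simp add: coadjoint_term_def nth_append omit_nth_snoc_eq)
  moreover have "coadjoint_term (us @ [w]) l y = snd (us ! l) (pr (omit_nth l (map fst us) @ [fst w, y]))"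
    if "l < n - 1" for l
    using assms that by (simp add: coadjoint_term_def nth_append omit_nth_snoc_less)
  ultimately show ?thesis by (simp add: snd_phase_bracket)
qed

text \<open>This is the dual identity with the leading argument moved behind \<open>zs\<close>; the
  sign (-1)^(n - 2) appears on both sides and cancels.\<close>

lemma action_bracket_last:
  assumes "length zs = n - 2" "length ys = n"
  shows "pr (zs @ [br ys, v]) =
    - (\<Sum>j<n. scale ((-1) ^ (n - Suc j)) (pr (zs @ [ys ! j, pr (omit_nth j ys @ [v])])))"
proof -
  have move: "pr (zs @ [u, z]) = scale ((-1) ^ length zs) (pr (u # zs @ [z]))" for u z
    using alternating_move[OF product.action_alternating[of z], of "[]" u zs "[]"] assms n
    by (simp add: nlists_iff in_nlists_UNIV UNIV)
  have "pr (br ys # zs @ [v]) =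
      - (\<Sum>j<n. scale ((-1) ^ (n - Suc j)) (pr (ys ! j # zs @ [pr (omit_nth j ys @ [v])])))"
    using assms by (intro product.dual_action_bracket) (simp_all add: nlists_iff in_nlists_UNIV UNIV)
  then show ?thesis
    unfolding move by (simp add: scale_sum_right mult.commute)
qed

lemma phase_bracket_fundamental_identity:
  assumes us: "us \<in> nlists (n - 1) (double_carrier scale)" and ws: "ws \<in> nlists n (double_carrier scale)"
  shows "phase_bracket (us @ [phase_bracket ws]) =
    (\<Sum>j<n. phase_bracket (ws[j := phase_bracket (us @ [ws ! j])]))"
proof (rule prod_eqI)
  define xs ys where "xs = map fst us" and "ys = map fst ws"
  have len: "length us = n - 1" "length ws = n" "length xs = n - 1" "length ys = n"
    using us ws by (simp_all add: nlistsE_length xs_def ys_def)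
  have ys: "map fst (ws[j := phase_bracket (us @ [ws ! j])]) = ys[j := br (xs @ [ys ! j])]" if "j < n" for j
    using that len by (simp add: map_update fst_phase_bracket xs_def ys_def)
  show "fst (phase_bracket (us @ [phase_bracket ws])) =
      fst (\<Sum>j<n. phase_bracket (ws[j := phase_bracket (us @ [ws ! j])]))"
    using fundamental_identity[of xs ys] len
    by (simp add: fst_sum fst_phase_bracket ys nlists_iff flip: xs_def ys_def)
  show "snd (phase_bracket (us @ [phase_bracket ws])) =
      snd (\<Sum>j<n. phase_bracket (ws[j := phase_bracket (us @ [ws ! j])]))"
  proof
    fix v
    define s :: "nat \<Rightarrow> 'k" where "s i = (-1) ^ (n - Suc i)" for i
    \<comment> \<open>F collects the functionals of \<open>us\<close>; A, B and C collect those of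
      \<open>ws\<close>. The F terms agree on both sides by the dual identity, and the others by
      \<open>action_commutator\<close>, which says that B is A plus the sum of the C terms.\<close>
    define F where "F l j = snd (us ! l) (pr (omit_nth l xs @ [ys ! j, pr (omit_nth j ys @ [v])]))" for l j
    define A where "A i = snd (ws ! i) (pr (omit_nth i ys @ [pr (xs @ [v])]))" for i
    define B where "B i = snd (ws ! i) (pr (xs @ [pr (omit_nth i ys @ [v])]))" for i
    define C where "C i j =
      snd (ws ! i) (pr ((omit_nth i ys)[unskip i j := br (xs @ [ys ! j])] @ [v]))" for i j
    have m: "n = Suc (n - 1)" using n by simp
    have BCA: "B i = (\<Sum>j\<in>{..<n} - {i}. C i j) + A i" if i: "i < n" for i
    proof -
      have lo: "length (omit_nth i ys) = n - 1" using i len by (simp add: length_omit_nth)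
      have "(\<Sum>j\<in>{..<n} - {i}. C i j) = (\<Sum>l<n - 1. C i (skip i l))"
        using sum_skip[of i "n - 1" "C i"] i m by simp
      also have "\<dots> = (\<Sum>l<n - 1. snd (ws ! i) (pr ((omit_nth i ys)[l := br (xs @ [omit_nth i ys ! l])] @ [v])))"
        using i len by (intro sum.cong[OF refl]) (simp add: C_def unskip_skip nth_omit_nth)
      finally have "(\<Sum>j\<in>{..<n} - {i}. C i j) + A i =
          snd (ws ! i) (pr (xs @ [pr (omit_nth i ys @ [v])]))"
        using product.action_commutator[of xs "omit_nth i ys" v] lo len in_double_nth[OF ws i]
        by (simp add: A_def nlists_iff in_nlists_UNIV UNIV dual_add dual_sum)
      then show ?thesis by (simp add: B_def)
    qed
    have "snd (us ! l) (pr (omit_nth l xs @ [br ys, v])) = - (\<Sum>j<n. s j * F l j)" if "l < n - 1" for l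
      using that len in_double_nth[OF us that]
      by (simp add: action_bracket_last length_omit_nth dual_minus dual_sum dual_scale F_def s_def)
    moreover have "snd (phase_bracket ws) (pr (xs @ [v])) = - (\<Sum>i<n. s i * A i)"
      by (simp add: snd_phase_bracket coadjoint_term_def A_def s_def ys_def)
    ultimately have lhs: "snd (phase_bracket (us @ [phase_bracket ws])) v =
        (\<Sum>l<n - 1. s l * (\<Sum>j<n. s j * F l j)) + (\<Sum>i<n. s i * A i)"
      using len by (simp add: snd_phase_bracket_snoc fst_phase_bracket sum_negf flip: xs_def ys_def s_def)
    have rhs: "snd (phase_bracket (ws[j := phase_bracket (us @ [ws ! j])])) v =
        s j * ((\<Sum>l<n - 1. s l * F l j) + B j) - (\<Sum>i\<in>{..<n} - {j}. s i * C i j)" if j: "j < n" for j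
    proof -
      let ?ws = "ws[j := phase_bracket (us @ [ws ! j])]"
      define X where "X = (\<Sum>l<n - 1. s l * F l j) + B j"
      have "coadjoint_term ?ws j v = - X"
        unfolding X_def
        using j len by (simp add: coadjoint_term_def ys omit_nth_update_same snd_phase_bracket_snoc
            F_def B_def s_def flip: xs_def) (simp add: ys_def)
      moreover have "coadjoint_term ?ws i v = C i j" if "i \<in> {..<n} - {j}" for i
        using that j len by (auto simp: coadjoint_term_def ys omit_nth_update_other C_def)
      ultimately show ?thesis
        unfolding snd_phase_bracket s_def[symmetric] X_def[symmetric]
        using j by (subst sum.remove[of _ j]) simp_all
    qed
    have "(\<Sum>j<n. snd (phase_bracket (ws[j := phase_bracket (us @ [ws ! j])])) v) =
        (\<Sum>j<n. s j * (\<Sum>l<n - 1. s l * F l j)) + (\<Sum>j<n. s j * B j) -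
        (\<Sum>j<n. \<Sum>i\<in>{..<n} - {j}. s i * C i j)"
      by (simp add: rhs sum_subtractf sum.distrib distrib_left)
    also have "(\<Sum>j<n. \<Sum>i\<in>{..<n} - {j}. s i * C i j) = (\<Sum>i<n. \<Sum>j\<in>{..<n} - {i}. s i * C i j)"
      by (rule sum_swap_distinct) simp
    also have "(\<Sum>j<n. s j * B j) = (\<Sum>i<n. \<Sum>j\<in>{..<n} - {i}. s i * C i j) + (\<Sum>i<n. s i * A i)"
      by (simp add: BCA distrib_left sum.distrib sum_distrib_left)
    also have "(\<Sum>j<n. s j * (\<Sum>l<n - 1. s l * F l j)) = (\<Sum>l<n - 1. s l * (\<Sum>j<n. s j * F l j))"
      unfolding sum_distrib_left by (subst sum.swap) (simp add: mult.left_commute)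
    finally show "snd (phase_bracket (us @ [phase_bracket ws])) v =
        snd (\<Sum>j<n. phase_bracket (ws[j := phase_bracket (us @ [ws ! j])])) v"
      by (simp add: lhs snd_sum sum_fun_apply)
  qed
qed

text \<open>Each pairing on the right splits into a coadjoint term, a summand of the commutator
  under the functional of w, and cross terms. The first two kinds add up to the left side; the cross
  terms cancel.\<close>

lemma phase_bracket_form:
  assumes us: "us \<in> nlists n (double_carrier scale)" and w: "w \<in> double_carrier scale"
  shows "double_form (phase_bracket us) w =
    - (\<Sum>i<n. (-1) ^ (n - Suc i) * double_form (us ! i) (phase_bracket (omit_nth i us @ [w])))"
proof -
  define xs y g where "xs = map fst us" and "y = fst w" and "g = snd w"
  define s :: "nat \<Rightarrow> 'k" where "s i = (-1) ^ (n - Suc i)" for i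
  have m: "n = Suc (n - 1)" using n by simp
  have len: "length us = n" "length xs = n" using us by (simp_all add: nlistsE_length xs_def)
  have g: "g \<in> dual_carrier scale" using w by (simp add: g_def mem_double_carrier_iff)
  \<comment> \<open>Cross terms involve two positions, one supplying the functional and the other
    the last vector. K exchanges these roles, as \<open>sum_skip_pairing\<close> requires.\<close>
  define H where "H i l = snd (us ! skip i l) (pr (omit_nth l (omit_nth i xs) @ [y, xs ! i]))" for i l
  define K where "K i l = snd (us ! i) (pr (omit_nth l (omit_nth i xs) @ [y, xs ! skip i l]))" for i l
  have "double_form (us ! i) (phase_bracket (omit_nth i us @ [w])) =
      coadjoint_term us i y + g (pr (omit_nth i xs @ [xs ! i])) + (\<Sum>l<n - 1. s l * (H i l + K i l))"
    if i: "i < n" for i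
  proof -
    note d = in_double_nth[OF us i]
    have lo: "length (omit_nth i xs) = n - 1" "length (omit_nth i us) = n - 1"
      using i len by (simp_all add: length_omit_nth)
    have "snd (phase_bracket (omit_nth i us @ [w])) (xs ! i) =
        - ((\<Sum>l<n - 1. s l * H i l) + g (pr (omit_nth i xs @ [xs ! i])))"
      using i len lo by (simp add: snd_phase_bracket_snoc map_omit_nth nth_omit_nth H_def s_def
          flip: xs_def y_def g_def)
    moreover have "snd (us ! i) (br (omit_nth i xs @ [y])) = (\<Sum>l<n - 1. s l * K i l) + coadjoint_term us i y"
    proof -
      let ?zs = "omit_nth i xs @ [y]"
      have "br ?zs = (\<Sum>l<n. scale (s l) (pr (omit_nth l ?zs @ [?zs ! l])))"
        using commutator_eq[of ?zs] lo n by (simp add: commutator_def s_def)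
      also have "\<dots> = (\<Sum>l<n - 1. scale (s l) (pr (omit_nth l ?zs @ [?zs ! l]))) +
          scale (s (n - 1)) (pr (omit_nth (n - 1) ?zs @ [?zs ! (n - 1)]))"
        by (subst (1) m, subst sum.lessThan_Suc) simp
      also have "scale (s (n - 1)) (pr (omit_nth (n - 1) ?zs @ [?zs ! (n - 1)])) = pr ?zs"
        using lo n by (simp add: omit_nth_snoc_eq nth_append s_def)
      also have "(\<Sum>l<n - 1. scale (s l) (pr (omit_nth l ?zs @ [?zs ! l]))) =
          (\<Sum>l<n - 1. scale (s l) (pr (omit_nth l (omit_nth i xs) @ [y, xs ! skip i l])))"
        using lo i len by (intro sum.cong[OF refl]) (simp add: omit_nth_snoc_less nth_append nth_omit_nth)
      finally show ?thesis
        using d by (simp add: dual_add dual_sum dual_scale K_def coadjoint_term_def flip: xs_def)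
    qed
    moreover have "fst (us ! i) = xs ! i" using i len by (simp add: xs_def)
    ultimately show ?thesis
      by (simp add: double_form_eq fst_phase_bracket map_omit_nth distrib_left sum.distrib
          flip: xs_def y_def)
  qed
  then have "(\<Sum>i<n. s i * double_form (us ! i) (phase_bracket (omit_nth i us @ [w]))) =
      (\<Sum>i<n. s i * coadjoint_term us i y) + (\<Sum>i<n. s i * g (pr (omit_nth i xs @ [xs ! i]))) +
      (\<Sum>i<n. \<Sum>l<n - 1. s i * (s l * (H i l + K i l)))"
    by (simp add: distrib_left sum.distrib sum_distrib_left)
  also have "(\<Sum>i<n. \<Sum>l<n - 1. s i * (s l * (H i l + K i l))) = 0"
  proof -
    have "(\<Sum>i<Suc (n - 1). \<Sum>l<n - 1. (-1) ^ (n - 1 - i) * ((-1) ^ (n - 1 - l) * (H i l + K i l))) = 0"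
      using m len by (intro sum_skip_pairing)
        (simp add: H_def K_def omit_nth_omit_nth skip_unskip)
    then show ?thesis using m by (simp add: s_def)
  qed
  also have "(\<Sum>i<n. s i * g (pr (omit_nth i xs @ [xs ! i]))) = g (br xs)"
    using commutator_eq[OF len(2)] by (simp add: commutator_def s_def dual_sum[OF g] dual_scale[OF g]
        flip: commutator_eq[OF len(2)])
  finally show ?thesis
    by (simp add: double_form_eq fst_phase_bracket snd_phase_bracket flip: xs_def y_def g_def s_def)
qed

lemma double_form_nondegenerate:
  assumes "\<And>q. q \<in> double_carrier scale \<Longrightarrow> double_form p q = 0"
  shows "p = 0"
proof (rule prod_eqI)
  have "snd p y = 0" for y
    using assms[of "(y, 0)"] by (simp add: double_form_eq mem_double_carrier_iff zero_in_dual_carrier)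
  then show snd: "snd p = snd 0" by (simp add: fun_eq_iff)
  have "f (fst p) = f 0" if "f \<in> dual_carrier scale" for f
    using assms[of "(0, f)"] that snd by (simp add: double_form_eq mem_double_carrier_iff dual_zero)
  then show "fst p = fst 0" by (simp add: dual_separates)
qed

lemma phase_bracket_symplectic:
  "symplectic_n_Lie_algebra n (double_scale scale) (double_carrier scale) phase_bracket double_form"
proof -
  interpret double: multilinear_operation n "double_scale scale" "double_carrier scale" phase_bracket
    by (rule multilinear_phase_bracket)
  show ?thesis
  proof unfold_locales
    show "p = 0" if "\<And>q. q \<in> double_carrier scale \<Longrightarrow> double_form p q = 0" for p
      using that by (rule double_form_nondegenerate)
  qed ((rule phase_bracket_form phase_bracket_skew phase_bracket_fundamental_identity; assumption)
      | simp add: double_form_eq mem_double_carrier_iff dual_add dual_scale algebra_simps)+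
qed

lemma phase_space_of_sub_adjacent: "phase_space n scale br phase_bracket"
  unfolding phase_space_def n_Lie_subalgebra_def
proof (intro conjI ballI)
  show "symplectic_n_Lie_algebra n (double_scale scale) (double_carrier scale) phase_bracket double_form"
    by (rule phase_bracket_symplectic)
  show "module.subspace (double_scale scale) (UNIV \<times> {0})" by (rule subspace_double_left)
  show "module.subspace (double_scale scale) ({0} \<times> dual_carrier scale)" by (rule subspace_double_right)
  show "UNIV \<times> {0} \<subseteq> double_carrier scale" "{0} \<times> dual_carrier scale \<subseteq> double_carrier scale"
    by (auto simp: mem_double_carrier_iff zero_in_dual_carrier)
next
  fix us :: "('a \<times> ('a \<Rightarrow> 'k)) list" assume us: "us \<in> nlists n (UNIV \<times> {0})"
  have "snd (us ! i) = 0" if "i < n" for i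
    using nlistsE_nth_in[OF us that] by auto
  then show "phase_bracket us \<in> UNIV \<times> {0}"
    by (auto simp: mem_Times_iff fun_eq_iff snd_phase_bracket coadjoint_term_def)
next
  fix xs :: "'a list" assume "xs \<in> nlists n UNIV"
  then have "length xs = n" by (simp add: in_nlists_UNIV)
  then show "phase_bracket (map (\<lambda>x. (x, 0)) xs) = (br xs, 0)"
    by (auto simp: prod_eq_iff fun_eq_iff fst_phase_bracket snd_phase_bracket coadjoint_term_def comp_def)
next
  fix us :: "('a \<times> ('a \<Rightarrow> 'k)) list" assume us: "us \<in> nlists n ({0} \<times> dual_carrier scale)"
  have len: "length us = n" using us by (rule nlistsE_length)
  have fst: "map fst us = replicate n 0"
    using us by (auto intro!: nth_equalityI simp: len dest: nlistsE_nth_in)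
  have rep: "replicate n (0 :: 'a) = 0 # replicate (n - 1) 0" "n - 1 = Suc (n - 2)"
    using n by (simp_all flip: replicate_Suc)
  have "br (map fst us) = 0"
    unfolding fst rep(1) using zero_append[of "[]" 0 "replicate (n - 1) 0"] n
    by (simp add: nlists_iff in_nlists_UNIV UNIV)
  \<comment> \<open>After the omission n - 1 vector parts remain, all zero; since n is at least 2,
    there is at least one of them among the arguments of \<open>pr\<close>.\<close>
  moreover have "coadjoint_term us i y = 0" if i: "i < n" for i y
  proof -
    have "omit_nth i (replicate n (0 :: 'a)) = 0 # replicate (n - 2) 0"
      using i n rep(2) by (intro nth_equalityI) (auto simp: length_omit_nth nth_omit_nth skip_def nth_Cons')
    then have "pr (omit_nth i (replicate n 0) @ [y]) = 0"
      using product.zero_append[of "[]" 0 "replicate (n - 2) 0 @ [y]"] n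
      by (simp add: nlists_iff in_nlists_UNIV UNIV)
    moreover have "snd (us ! i) \<in> dual_carrier scale" using nlistsE_nth_in[OF us i] by auto
    ultimately show ?thesis by (simp add: coadjoint_term_def fst dual_zero)
  qed
  then have "snd (phase_bracket us) = 0" by (simp add: fun_eq_iff snd_phase_bracket)
  ultimately show "phase_bracket us \<in> {0} \<times> dual_carrier scale"
    by (simp add: mem_Times_iff fst_phase_bracket zero_in_dual_carrier)
qed

end

end

theorem theorem4p4:
  fixes scale :: "'k::field_char_0 \<Rightarrow> 'h::ab_group_add \<Rightarrow> 'h"
    and br :: "'h list \<Rightarrow> 'h"
    and n :: nat
  assumes "n \<ge> 2"
    and "n_Lie_algebra n scale UNIV br"
  shows "(\<exists>br'. phase_space n scale br br') \<longleftrightarrow> (\<exists>pr. sub_adjacent n scale UNIV pr br)"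
proof -
  interpret n_Lie_algebra n scale UNIV br by fact
  show ?thesis
    using sub_adjacent_of_phase_space[OF _ refl assms(1)] phase_space_of_sub_adjacent[OF _ refl assms(1)]
    by blast
qed

end
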